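(* Let $p$ and $r$ be distinct primes with $p\equiv1\pmod3$ and $\gcd(3,r)=1$. Let $t\ge1$, $m=3t$, $q=p^m$, $c=\frac{q-1}{3}$ and $k=\frac3r\Psi_r(q)$, and assume $q\equiv1\pmod r$. Let $a,b$ be integers with $4p^t=a^2+27b^2$, $a\equiv1\pmod3$ and $\gcd(a,p)=1$. For non-negative integers $\ell_1,\ell_2,\ell_3$ with $h=\ell_1+\ell_2+\ell_3\le r$ put $$w_{\ell_1,\ell_2,\ell_3}=\tfrac{p-1}{3p}\Big(hq+\big(a(\tfrac{\ell_2+\ell_3}{2}-\ell_1)+\tfrac{9b}{2}(\ell_2-\ell_3)\big)p^t\Big),\qquad A_{\ell_1,\ell_2,\ell_3}=\binom{r}{h}\binom{h}{\ell_1,\ell_2,\ell_3}c^h.$$ Then the weights of $\mathcal{C}(k,q^r)$ are the numbers $w_{\ell_1,\ell_2,\ell_3}$, with frequencies $A_{\ell_1,\ell_2,\ell_3}$ (frequencies of tuples giving the same weight being added).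
   Context: $\Psi_r(x)=x^{r-1}+\cdots+x+1$. Let $Q=p^M$, $\omega$ a primitive element of $\mathbb{F}_Q$, $k\mid Q-1$, $n=\frac{Q-1}{k}$. The irreducible cyclic code $\mathcal{C}(k,Q)\subseteq\mathbb{F}_p^n$ consists of the words $c_\gamma=(\mathrm{Tr}_{Q/p}(\gamma\,\omega^{ki}))_{i=0}^{n-1}$, $\gamma\in\mathbb{F}_Q$; the weight of a word is its number of nonzero coordinates, and the frequency of $w$ is $\#\{\gamma\in\mathbb{F}_Q: w(c_\gamma)=w\}$. *)

theory Defs
  imports Complex_Main "HOL-Library.Cardinality" "HOL-Computational_Algebra.Primes"
begin

definition Psi :: "nat \<Rightarrow> nat \<Rightarrow> nat" where
  "Psi r x = (\<Sum>i<r. x ^ i)"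

definition primitive_element :: "'a::{field,finite} \<Rightarrow> bool" where
  "primitive_element \<omega> \<longleftrightarrow> \<omega> \<noteq> 0 \<and> (\<forall>x. x \<noteq> 0 \<longrightarrow> (\<exists>i::nat. x = \<omega> ^ i))"

text \<open>Absolute trace Tr_{Q/p}, Q = p^M, computed inside F_Q (its values lie in the prime field).\<close>
definition trace_field :: "nat \<Rightarrow> nat \<Rightarrow> 'a::{field,finite} \<Rightarrow> 'a" where
  "trace_field p M x = (\<Sum>i<M. x ^ (p ^ i))"

text \<open>Weight of the codeword c_gamma of the irreducible cyclic code C(k,Q), Q = p^M = CARD('a),
  n = (Q-1)/k: number of indices i < n with Tr(gamma * omega^(k i)) nonzero.\<close>
definition cyc_weight :: "nat \<Rightarrow> nat \<Rightarrow> nat \<Rightarrow> 'a::{field,finite} \<Rightarrow> 'a \<Rightarrow> nat" where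
  "cyc_weight p M k \<omega> \<gamma> =
     card {i \<in> {0..<(CARD('a) - 1) div k}. trace_field p M (\<gamma> * \<omega> ^ (k * i)) \<noteq> 0}"

definition cyc_freq :: "nat \<Rightarrow> nat \<Rightarrow> nat \<Rightarrow> 'a::{field,finite} \<Rightarrow> nat \<Rightarrow> nat" where
  "cyc_freq p M k \<omega> w = card {\<gamma>::'a. cyc_weight p M k \<omega> \<gamma> = w}"

end

theory Submission
  imports Defs "HOL-Library.Multiset" "HOL-Library.FuncSet"
    "HOL-Computational_Algebra.Polynomial" "HOL-Number_Theory.Cong"
begin

text \<open>
  Write \<open>Q = q^r\<close>, let \<open>g\<close> generate the units of the subfield \<open>K = F_q\<close>, and put \<open>\<beta> = \<omega>^k\<close>, so that
  \<open>\<beta>^r = g^3\<close>. Splitting the index as \<open>i = r j + s\<close> shows that the weight of \<open>c_\<gamma>\<close> is the sum over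
  \<open>s < r\<close> of the weights \<open>W\<close> of the words \<open>(tr (x_s g^(3 j)))_j\<close> with \<open>x_s = Tr_{Q/q}(\<gamma> \<beta>^s)\<close>. As
  \<open>\<beta>^(q - 1)\<close> is a primitive \<open>r\<close>-th root of unity, a discrete Fourier inversion recovers \<open>\<gamma>\<close> from
  \<open>(x_s)\<close>, so the weight enumerator is the \<open>r\<close>-th power of that of the cubic code over \<open>F_q\<close>.

  The latter is governed by the cubic exponential sums \<open>E u = \<Sum>y\<in>K. \<psi> (u y^3)\<close>, which are
  rational integers since the units of \<open>F_p\<close> are cubes in \<open>K\<close>. Their first three moments show that
  the three values of \<open>E\<close> on units are the roots of \<open>X^3 - 3 q X - q A\<close>, where modulo \<open>p\<close> the
  integer \<open>A\<close> is minus the number of solutions of \<open>x^3 + y^3 + z^3 = 0\<close> in \<open>K\<close>, that is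
  \<open>- (2 c choose c)\<close>, which is nonzero. Hence every root is exactly divisible by \<open>p^t\<close>. After division by
  \<open>p^t\<close>, two of the roots agree modulo 9, and this produces a representation
  \<open>4 p^t = a'^2 + 27 b'^2\<close> with \<open>a'\<close> prime to \<open>p\<close>; such a representation is unique up to signs.
\<close>

section \<open>Arithmetic\<close>

text \<open>One step of Legendre's formula: only multiples of \<open>p\<close> contribute, and
  taking one factor \<open>p\<close> out of each of them leaves
  \<open>fact (n div p)\<close>.\<close>

lemma multiplicity_fact_prime:
  fixes p :: nat
  assumes "prime p"
  shows "multiplicity p (fact n :: nat) = n div p + multiplicity p (fact (n div p) :: nat)"
proof (induction n)
  case 0
  then show ?case by simp
next
  case (Suc n)
  have p: "p > 1" using assms prime_gt_1_nat by blast
  have fs: "multiplicity p (fact (Suc i) :: nat) = multiplicity p (Suc i) + multiplicity p (fact i :: nat)" for i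
    using assms by (simp only: fact_Suc of_nat_id)
      (rule prime_elem_multiplicity_mult_distrib, auto)
  show ?case
  proof (cases "p dvd Suc n")
    case False
    then have "Suc n div p = n div p" by (simp add: div_Suc dvd_eq_mod_eq_0)
    with False show ?thesis using Suc.IH by (simp only: fs) (simp add: not_dvd_imp_multiplicity_0)
  next
    case True
    then have d: "Suc n div p = Suc (n div p)" by (simp add: div_Suc dvd_eq_mod_eq_0)
    then have "Suc n = p * Suc (n div p)" using True by (metis dvd_mult_div_cancel)
    then have "multiplicity p (Suc n) = multiplicity p (p * Suc (n div p))" by metis
    also have "\<dots> = Suc (multiplicity p (Suc (n div p)))"
      by (rule multiplicity_times_same) (use p in auto)
    finally have m: "multiplicity p (Suc n) = Suc (multiplicity p (Suc (n div p)))" .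
    show ?thesis unfolding d fs m Suc.IH by simp
  qed
qed

lemma mod3_power_eq_1:
  fixes p :: nat
  assumes "p mod 3 = 1"
  shows "p ^ e mod 3 = 1"
  using assms power_mod[of p 3 e] by simp

text \<open>All \<open>e\<close> base-\<open>p\<close> digits of \<open>N e\<close> equal
  \<open>(p - 1) / 3\<close>, so doubling \<open>N e\<close> produces no carry. This is Kummer's
  criterion, reached by comparing multiplicities of factorials.\<close>

lemma not_prime_dvd_binomial_third:
  fixes p e :: nat
  assumes "prime p" and "p mod 3 = 1"
  defines "N \<equiv> (\<lambda>e. (p ^ e - 1) div 3)"
  shows "\<not> p dvd (2 * N e choose N e)"
proof -
  have p: "p > 1" using assms prime_gt_1_nat by blast
  have m3: "p ^ e mod 3 = 1" for e
    by (rule mod3_power_eq_1) (rule assms)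
  have N3: "p ^ e = 3 * N e + 1" for e
  proof -
    have "p ^ e = 3 * (p ^ e div 3) + 1" using m3[of e] by (metis mult_div_mod_eq)
    then show ?thesis unfolding N_def by (metis add_diff_cancel_right' nonzero_mult_div_cancel_left zero_neq_numeral)
  qed
  obtain u where u: "p = 3 * u + 1" using N3[of 1] by auto
  have NS: "N (Suc e) = p * N e + u" for e
    using N3[of e] N3[of "Suc e"] u by (simp add: algebra_simps)
  have mult: "multiplicity p (fact (2 * N e) :: nat) = 2 * multiplicity p (fact (N e) :: nat)"
  proof (induction e)
    case 0
    then show ?case by (simp add: N_def)
  next
    case (Suc e)
    \<comment> \<open>No carry: the lowest digit \<open>u\<close> satisfies \<open>2 * u < p\<close>
      because \<open>p = 3 * u + 1\<close>.\<close>
    have "N (Suc e) div p = N e" "2 * N (Suc e) div p = 2 * N e"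
      using u p by (auto intro!: div_nat_eqI simp: NS algebra_simps)
    then show ?case using Suc
      multiplicity_fact_prime[OF assms(1), of "N (Suc e)"] multiplicity_fact_prime[OF assms(1), of "2 * N (Suc e)"]
      by simp
  qed
  define B where "B = (2 * N e choose N e)"
  have "fact (N e) * fact (2 * N e - N e) * B = (fact (2 * N e) :: nat)"
    unfolding B_def by (rule binomial_fact_lemma) simp
  then have eq: "(fact (2 * N e) :: nat) = fact (N e) * (fact (N e) * B)" by (simp add: mult_2 mult.assoc)
  have "B \<noteq> 0" unfolding B_def by simp
  then have "multiplicity p (fact (2 * N e) :: nat) = multiplicity p (fact (N e) :: nat) + (multiplicity p (fact (N e) :: nat) + multiplicity p B)"
    unfolding eq using assms(1) by (simp add: prime_elem_multiplicity_mult_distrib)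
  then have "multiplicity p B = 0" using mult by simp
  then show ?thesis using p \<open>B \<noteq> 0\<close> unfolding B_def[symmetric]
    by (simp add: multiplicity_eq_zero_iff prime_nat_iff)
qed

text \<open>With \<open>P = p ^ t\<close>, composing the two representations writes
  \<open>16 * P ^ 2\<close> as a square plus 27 times the square of \<open>a * b' - a' * b\<close>.
  If \<open>P\<close> divides that difference, size forces it to vanish. The residue modulo 3 fixes
  the sign of \<open>a\<close>; that of \<open>b\<close> stays free.\<close>

lemma form_1_27_unique:
  fixes a b a' b' :: int and p t :: nat
  assumes "prime p" "p mod 3 = 1"
    and ab: "4 * int p ^ t = a\<^sup>2 + 27 * b\<^sup>2" and ab': "4 * int p ^ t = a'\<^sup>2 + 27 * b'\<^sup>2"
    and "\<not> int p dvd a" "\<not> int p dvd a'" "a mod 3 = 1" "a' mod 3 = 1"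
  shows "a' = a \<and> (b' = b \<or> b' = - b)"
proof -
  define P where "P = int p ^ t"
  have pr: "prime (int p)" using assms by simp
  have P: "P > 0" unfolding P_def using prime_gt_0_nat[OF \<open>prime p\<close>] by simp
  have p2: "\<not> int p dvd 2"
  proof
    assume "int p dvd 2"
    then have "p dvd 2" by presburger
    then have "p \<le> 2" by (simp add: dvd_imp_le)
    moreover have "p \<ge> 2" using assms(1) by (rule prime_ge_2_nat)
    ultimately show False using assms(2) by simp
  qed
  \<comment> \<open>Here \<open>b'\<close> is quantified anew, so that the fact also applies to
    \<open>- b'\<close> when \<open>P\<close> divides the other factor.\<close>
  have key: "b'\<^sup>2 = b\<^sup>2" if d: "P dvd a * b' - a' * b"  and ab': "4 * P = a'\<^sup>2 + 27 * b'\<^sup>2" for b'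
  proof -
    from d obtain k where k: "a * b' - a' * b = P * k" by blast
    have "(a * a' + 27 * b * b')\<^sup>2 + 27 * (a * b' - a' * b)\<^sup>2 = (a\<^sup>2 + 27 * b\<^sup>2) * (a'\<^sup>2 + 27 * b'\<^sup>2)"
      by (simp add: power2_eq_square algebra_simps)
    also have "\<dots> = (4 * P) * (4 * P)" using ab ab' by (simp only: P_def)
    also have "\<dots> = 16 * P\<^sup>2" by (simp add: power2_eq_square)
    finally have "27 * (P * k)\<^sup>2 \<le> 16 * P\<^sup>2" unfolding k by (metis le_add_same_cancel2 zero_le_power2)
    then have "27 * k\<^sup>2 \<le> 16" using P by (simp add: power_mult_distrib mult.left_commute[of 27])
    then have "k\<^sup>2 \<le> 0" by linarith
    then have "k = 0" by simp
    then have "(a * b')\<^sup>2 = (a' * b)\<^sup>2" using k by simp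
    then have "(4 * P - 27 * b\<^sup>2) * b'\<^sup>2 = (4 * P - 27 * b'\<^sup>2) * b\<^sup>2"
      using ab ab' unfolding P_def[symmetric] by (simp add: power_mult_distrib)
    then have "4 * P * b'\<^sup>2 = 4 * P * b\<^sup>2" by (simp add: algebra_simps)
    then show ?thesis using P by simp
  qed
  \<comment> \<open>\<open>p\<close> divides at most one of the two factors, so \<open>p ^ t\<close> divides one of them.\<close>
  have prod: "P dvd (a * b' - a' * b) * (a * b' + a' * b)"
  proof -
    have "(a * b' - a' * b) * (a * b' + a' * b) = a\<^sup>2 * b'\<^sup>2 - a'\<^sup>2 * b\<^sup>2"
      by (simp add: power2_eq_square algebra_simps)
    also have "\<dots> = (4 * P - 27 * b\<^sup>2) * b'\<^sup>2 - (4 * P - 27 * b'\<^sup>2) * b\<^sup>2"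
      using ab ab' by (simp add: P_def)
    also have "\<dots> = P * (4 * (b'\<^sup>2 - b\<^sup>2))" by (simp add: algebra_simps)
    finally show ?thesis by simp
  qed
  have nd: "\<not> (int p dvd a * b' - a' * b \<and> int p dvd a * b' + a' * b)" if "t > 0"
  proof
    assume "int p dvd a * b' - a' * b \<and> int p dvd a * b' + a' * b"
    then have "int p dvd (a * b' - a' * b) + (a * b' + a' * b)" using dvd_add by blast
    then have "int p dvd 2 * (a * b')" by simp
    then have "int p dvd b'" using p2 assms(5) pr by (simp add: prime_dvd_mult_iff)
    moreover have "int p dvd 4 * int p ^ t" using that by (simp add: dvd_power)
    ultimately have "int p dvd a'\<^sup>2 + 27 * b'\<^sup>2" "int p dvd 27 * b'\<^sup>2" using ab' by (auto simp: power2_eq_square)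
    then have "int p dvd a'\<^sup>2" by (simp add: dvd_add_left_iff)
    then show False using pr assms(6) prime_dvd_power by blast
  qed
  have cases: "P dvd a * b' - a' * b \<or> P dvd a * b' + a' * b"
  proof (cases "t = 0")
    case True then show ?thesis by (simp add: P_def)
  next
    case False
    with nd consider "\<not> int p dvd a * b' - a' * b" | "\<not> int p dvd a * b' + a' * b" by blast
    then show ?thesis
    proof cases
      case 1
      then have "coprime P (a * b' - a' * b)" unfolding P_def
        using pr prime_imp_coprime by (metis coprime_power_left_iff)
      then show ?thesis using prod by (metis coprime_dvd_mult_right_iff)
    next
      case 2
      then have "coprime P (a * b' + a' * b)" unfolding P_def
        using pr prime_imp_coprime by (metis coprime_power_left_iff)
      then show ?thesis using prod by (metis coprime_dvd_mult_left_iff)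
    qed
  qed
  have sq: "b'\<^sup>2 = b\<^sup>2"
  proof (rule disjE[OF cases])
    assume "P dvd a * b' - a' * b" then show ?thesis using key ab' P_def by simp
  next
    assume "P dvd a * b' + a' * b"
    then have "P dvd - (a * b' + a' * b)" by (simp only: dvd_minus_iff)
    then have "P dvd a * (- b') - a' * b" by (simp add: algebra_simps)
    from key[OF this] ab' show ?thesis by (simp add: P_def)
  qed
  then have "a'\<^sup>2 = a\<^sup>2" using ab ab' by simp
  then have "a' = a \<or> a' = - a" by (simp add: power2_eq_iff)
  moreover have "a' \<noteq> - a" using assms(7,8) by presburger
  ultimately show ?thesis using sq by (auto simp: power2_eq_iff)
qed

text \<open>Compare exponents of \<open>p\<close>: it divides \<open>E\<close>, hence not
  \<open>3 * E + A\<close>, so its exponent in \<open>E ^ 3\<close> is exactly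
  \<open>3 * t\<close>.\<close>

lemma root_depressed_cubic_multiplicity:
  fixes E A :: int and p t :: nat
  assumes "prime p" "t \<ge> 1" and cub: "E ^ 3 = int p ^ (3 * t) * (3 * E + A)" and A: "\<not> int p dvd A"
  obtains e where "E = int p ^ t * e" "\<not> int p dvd e"
proof -
  have pr: "prime (int p)" using assms by simp
  have "int p dvd E ^ 3" unfolding cub using assms(2) by (intro dvd_mult2 dvd_power) auto
  then have pE: "int p dvd E" using pr prime_dvd_power by blast
  then have nd: "\<not> int p dvd 3 * E + A" using A by (simp add: dvd_add_right_iff)
  have nz: "E \<noteq> 0" using cub nd pr by (metis dvd_0_right mult_eq_0_iff not_prime_0 power_eq_0_iff power_zero_numeral)
  then have "3 * multiplicity (int p) E = multiplicity (int p) (E ^ 3)"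
    using pr by (simp add: prime_elem_multiplicity_power_distrib)
  also have "\<dots> = multiplicity (int p) (int p ^ (3 * t)) + multiplicity (int p) (3 * E + A)"
    unfolding cub using pr nd by (intro prime_elem_multiplicity_mult_distrib) (auto simp: prime_gt_0_int)
  also have "\<dots> = 3 * t" using pr nd by (simp add: not_dvd_imp_multiplicity_0 prime_gt_0_int)
  finally have "multiplicity (int p) E = t" by simp
  then show ?thesis using that multiplicity_decompose'[OF nz, of "int p"] pr
    by (metis not_prime_unit)
qed

text \<open>The arithmetic core, detached from the field. Which cubic class carries which value is
  left open, hence an equality of multisets.\<close>

lemma multiset_of_cubic_periods:
  fixes E0 E1 E2 M a b :: int and p t :: nat
  defines "q \<equiv> int p ^ (3 * t)"
  assumes "prime p" "p mod 3 = 1" "t \<ge> 1"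
    and s1: "E0 + E1 + E2 = 0" and s2: "E0\<^sup>2 + E1\<^sup>2 + E2\<^sup>2 = 6 * q"
    and s3: "(q - 1) * (E0 * E1 * E2) = q * (M - q\<^sup>2)" and M: "\<not> int p dvd M"
    and m3: "E0 mod 3 = 1" "E1 mod 3 = 1" "E2 mod 3 = 1"
    and ab: "4 * int p ^ t = a\<^sup>2 + 27 * b\<^sup>2" "a mod 3 = 1" "\<not> int p dvd a"
  shows "\<exists>x y z. {#E0, E1, E2#} = {#x, y, z#} \<and> x = a * int p ^ t
    \<and> 2 * y = - (a + 9 * b) * int p ^ t \<and> 2 * z = - (a - 9 * b) * int p ^ t"
proof -
  define P where "P = int p ^ t"
  have pr: "prime (int p)" using assms by simp
  have P: "P > 0" unfolding P_def using prime_gt_0_nat[OF \<open>prime p\<close>] by simp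
  have qP: "q = P ^ 3" unfolding q_def P_def by (simp add: power_mult[symmetric] mult.commute)
  have pq: "int p dvd q" unfolding q_def using assms(4) by (intro dvd_power) auto
  have "coprime q (q - 1)" by (metis coprime_commute coprime_diff_one_left)
  moreover have "q dvd (q - 1) * (E0 * E1 * E2)" unfolding s3 by simp
  ultimately have "q dvd E0 * E1 * E2" by (simp add: coprime_dvd_mult_right_iff)
  then obtain A where A: "E0 * E1 * E2 = q * A" by blast
  have "q * ((q - 1) * A) = q * (M - q\<^sup>2)" using s3 unfolding A by (simp add: mult.left_commute)
  then have "(q - 1) * A = M - q\<^sup>2" using qP P by simp
  \<comment> \<open>Modulo \<open>p\<close> this reads \<open>M = - A\<close>, which carries the
    hypothesis on \<open>M\<close> over to \<open>A\<close>.\<close>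
  then have "M = q * (A + q) - A" by (simp add: algebra_simps power2_eq_square)
  then have pA: "\<not> int p dvd A" using M pq by (metis dvd_diff dvd_mult2)
  have s2': "E0 * E1 + E0 * E2 + E1 * E2 = - 3 * q"
  proof -
    have "(E0 + E1 + E2)\<^sup>2 = (E0\<^sup>2 + E1\<^sup>2 + E2\<^sup>2) + 2 * (E0 * E1 + E0 * E2 + E1 * E2)"
      by (simp add: power2_eq_square algebra_simps)
    then show ?thesis using s1 s2 by simp
  qed
  \<comment> \<open>The elementary symmetric functions of the three values are \<open>0\<close>,
    \<open>- 3 * q\<close> and \<open>q * A\<close>.\<close>
  have root: "E ^ 3 = q * (3 * E + A)" if "E \<in> {E0, E1, E2}" for E
  proof -
    have "(E - E0) * (E - E1) * (E - E2) = 0" using that by auto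
    moreover have "(E - E0) * (E - E1) * (E - E2) = E ^ 3 - (E0 + E1 + E2) * E\<^sup>2 + (E0 * E1 + E0 * E2 + E1 * E2) * E - E0 * E1 * E2"
      by (simp add: power2_eq_square power3_eq_cube algebra_simps)
    ultimately have "E ^ 3 - (- (3 * q)) * (- E) - q * A = 0" unfolding s1 s2' A by simp
    then show ?thesis by (simp add: algebra_simps)
  qed
  have ex: "\<exists>e. E = P * e \<and> \<not> int p dvd e" if "E \<in> {E0, E1, E2}" for E
    using root_depressed_cubic_multiplicity[OF assms(2,4) _ pA, of E] root[OF that] unfolding q_def P_def by metis
  from ex[of E0] ex[of E1] ex[of E2] obtain e0 e1 e2 where
    e: "E0 = P * e0" "E1 = P * e1" "E2 = P * e2" and nd: "\<not> int p dvd e0" "\<not> int p dvd e1" "\<not> int p dvd e2" by auto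
  have P3: "P mod 3 = 1" unfolding P_def using mod3_power_eq_1[OF assms(3), of t]
    by (metis of_nat_1 of_nat_mod of_nat_numeral of_nat_power)
  have em: "x mod 3 = 1" if "(P * x) mod 3 = 1" for x
    using that P3 by (metis mod_mult_left_eq mult_1)
  have e3: "e0 mod 3 = 1" "e1 mod 3 = 1" "e2 mod 3 = 1" using em m3 unfolding e by blast+
  have t1: "e0 + e1 + e2 = 0" using s1 P unfolding e by (metis distrib_left mult_eq_0_iff less_irrefl)
  have "P\<^sup>2 * (e0\<^sup>2 + e1\<^sup>2 + e2\<^sup>2) = P\<^sup>2 * (6 * P)" using s2 unfolding e qP
    by (simp add: power2_eq_square power3_eq_cube algebra_simps)
  then have t2: "e0\<^sup>2 + e1\<^sup>2 + e2\<^sup>2 = 6 * P" using P by simp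
  \<comment> \<open>The root \<open>f0\<close> is set apart, while \<open>f1\<close> and
    \<open>f2\<close> agree modulo 9. With \<open>d = (f1 - f2) / 9\<close> the sum of squares turns
    into the form \<open>f0 ^ 2 + 27 * d ^ 2\<close>.\<close>
  have fin: "\<exists>x y z. {#E0, E1, E2#} = {#x, y, z#} \<and> x = a * int p ^ t
    \<and> 2 * y = - (a + 9 * b) * int p ^ t \<and> 2 * z = - (a - 9 * b) * int p ^ t"
    if perm: "{#E0, E1, E2#} = {#P * f0, P * f1, P * f2#}" and f: "f0 + f1 + f2 = 0" "f0\<^sup>2 + f1\<^sup>2 + f2\<^sup>2 = 6 * P"
      "f0 mod 3 = 1" "\<not> int p dvd f0" "9 dvd f1 - f2" for f0 f1 f2
  proof -
    from f(5) obtain d where d: "f1 - f2 = 9 * d" by blast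
    have f12: "2 * f1 = - f0 + 9 * d" "2 * f2 = - f0 - 9 * d" using d f(1) by auto
    have "24 * P = 4 * f0\<^sup>2 + (2 * f1)\<^sup>2 + (2 * f2)\<^sup>2" using f(2) by (simp add: power_mult_distrib)
    also have "\<dots> = 6 * (f0\<^sup>2 + 27 * d\<^sup>2)" unfolding f12 by (simp add: power2_eq_square algebra_simps)
    finally have "4 * int p ^ t = f0\<^sup>2 + 27 * d\<^sup>2" by (simp add: P_def)
    from form_1_27_unique[OF assms(2,3) ab(1) this ab(3) f(4) ab(2) f(3)]
    have "f0 = a" and db: "d = b \<or> d = - b" by auto
    have x: "P * f0 = a * P" using \<open>f0 = a\<close> by simp
    have y: "2 * (P * f1) = (- a + 9 * d) * P" "2 * (P * f2) = (- a - 9 * d) * P"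
      using f12 \<open>f0 = a\<close> by (metis mult.assoc mult.commute)+
    from db show ?thesis
    proof
      assume "d = b"
      then have "2 * (P * f2) = - (a + 9 * b) * P" "2 * (P * f1) = - (a - 9 * b) * P" using y by (auto simp: algebra_simps)
      moreover have "{#E0, E1, E2#} = {#P * f0, P * f2, P * f1#}" using perm by (simp add: add_mset_commute)
      ultimately show ?thesis using x unfolding P_def by blast
    next
      assume "d = - b"
      then have "2 * (P * f1) = - (a + 9 * b) * P" "2 * (P * f2) = - (a - 9 * b) * P" using y by (auto simp: algebra_simps)
      then show ?thesis using x perm unfolding P_def by blast
    qed
  qed
  \<comment> \<open>The \<open>f e\<^sub>i\<close> sum to \<open>- 1\<close>, so modulo 3 they are neither all equal nor all distinct.\<close>
  define f where "f x = x div 3" for x :: int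
  have ef: "e0 = 3 * f e0 + 1" "e1 = 3 * f e1 + 1" "e2 = 3 * f e2 + 1"
    using e3 unfolding f_def by presburger+
  have "f e2 = - 1 - f e0 - f e1" using ef t1 by linarith
  then have "3 dvd f e1 - f e2 \<or> 3 dvd f e0 - f e2 \<or> 3 dvd f e0 - f e1" by presburger
  moreover have "9 dvd x - y" if "3 dvd u - v" "x = 3 * u + 1" "y = 3 * v + 1" for x y u v :: int
    using that by presburger
  ultimately have "9 dvd e1 - e2 \<or> 9 dvd e0 - e2 \<or> 9 dvd e0 - e1" using ef by metis
  then show ?thesis
  proof (elim disjE)
    assume "9 dvd e1 - e2"
    then show ?thesis using fin[of e0 e1 e2] e t1 t2 e3 nd by simp
  next
    assume "9 dvd e0 - e2"
    then show ?thesis using fin[of e1 e0 e2] e t1 t2 e3 nd by (simp add: add_mset_commute add_ac)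
  next
    assume "9 dvd e0 - e1"
    then show ?thesis using fin[of e2 e0 e1] e t1 t2 e3 nd by (simp add: add_mset_commute add_ac)
  qed
qed

text \<open>Three nested binomial expansions. The summand 1 will stand for a zero coordinate;
  splitting it off first produces the factor \<open>r choose (l1 + l2 + l3)\<close>.\<close>

lemma multinomial_4:
  fixes x y z :: "'b::comm_semiring_1"
  shows "(1 + (x + (y + z))) ^ r = (\<Sum>(l1, l2, l3)\<in>{(l1::nat, l2::nat, l3::nat). l1 + l2 + l3 \<le> r}.
     of_nat ((r choose (l1 + l2 + l3)) * (fact (l1 + l2 + l3) div (fact l1 * fact l2 * fact l3)))
       * (x ^ l1 * y ^ l2 * z ^ l3))"
proof -
  define D where "D = (SIGMA h:{..r}. SIGMA l:{..h}. {..h - l})"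
  have co: "((l1 + l2 + l3) choose l1) * ((l2 + l3) choose l2) = fact (l1 + l2 + l3) div (fact l1 * fact l2 * fact l3)" for l1 l2 l3 :: nat
  proof -
    have "fact l1 * fact (l2 + l3) * ((l1 + l2 + l3) choose l1) = (fact (l1 + l2 + l3) :: nat)"
      using binomial_fact_lemma[of l1 "l1 + l2 + l3"] by (simp add: add.assoc)
    moreover have "(fact (l2 + l3) :: nat) = fact l2 * fact l3 * ((l2 + l3) choose l2)"
      using binomial_fact_lemma[of l2 "l2 + l3"] by simp
    ultimately have "fact l1 * (fact l2 * fact l3 * ((l2 + l3) choose l2)) * ((l1 + l2 + l3) choose l1) = (fact (l1 + l2 + l3) :: nat)"
      by simp
    then have "fact (l1 + l2 + l3) = (fact l1 * fact l2 * fact l3) * (((l1 + l2 + l3) choose l1) * ((l2 + l3) choose l2))"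
      by (simp only: mult_ac)
    then show ?thesis by simp
  qed
  have co': "(h choose l) * (h - l choose i) = fact h div (fact l * fact i * fact (h - (l + i)))"
    if "l \<le> h" "i \<le> h - l" for h l i :: nat
    using co[of l i "h - (l + i)"] that by simp
  have "(1 + (x + (y + z))) ^ r = (\<Sum>h\<le>r. of_nat (r choose h) * (x + (y + z)) ^ h)"
    using binomial_ring[of "x + (y + z)" 1 r] by (simp add: add.commute)
  also have "\<dots> = (\<Sum>h\<le>r. \<Sum>l\<le>h. \<Sum>i\<le>h - l. of_nat ((r choose h) * ((h choose l) * ((h - l) choose i))) * (x ^ l * y ^ i * z ^ (h - l - i)))"
    by (simp only: binomial_ring[of x] binomial_ring[of y] sum_distrib_left of_nat_mult mult_ac)
  also have "\<dots> = (\<Sum>(h, l, i)\<in>D. of_nat ((r choose h) * ((h choose l) * ((h - l) choose i))) * (x ^ l * y ^ i * z ^ (h - l - i)))"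
    unfolding D_def by (simp add: sum.Sigma)
  also have "\<dots> = (\<Sum>(l1, l2, l3)\<in>{(l1::nat, l2::nat, l3::nat). l1 + l2 + l3 \<le> r}.
     of_nat ((r choose (l1 + l2 + l3)) * (fact (l1 + l2 + l3) div (fact l1 * fact l2 * fact l3)))
       * (x ^ l1 * y ^ l2 * z ^ l3))"
    by (rule sum.reindex_bij_witness[where j = "\<lambda>(h, l, i). (l, i, h - l - i)" and i = "\<lambda>(l1, l2, l3). (l1 + l2 + l3, l1, l2)"])
       (auto simp: D_def co'[symmetric])
  finally show ?thesis .
qed

section \<open>Auxiliary sums and monomials\<close>

lemma sum_lessThan_add:
  fixes f :: "nat \<Rightarrow> 'b::comm_monoid_add"
  shows "sum f {..<a + b} = sum f {..<a} + (\<Sum>i<b. f (a + i))"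
  by (induction b) (auto simp: add.assoc)

lemma geometric_sum_eq_0:
  fixes z :: "'b::idom"
  assumes "z ^ n = 1" "z \<noteq> 1"
  shows "(\<Sum>i<n. z ^ i) = 0"
  using assms power_diff_1_eq[of z n] by simp

lemma int_eq_of_complex: "(of_int x :: complex) = of_nat n \<Longrightarrow> x = int n"
  by (metis of_int_eq_iff of_int_of_nat_eq)

lemma prod_monom:
  "(\<Prod>i\<in>A. monom 1 (f i)) = (monom 1 (sum f A) :: 'b::comm_semiring_1 poly)"
  by (induction A rule: infinite_finite_induct) (auto simp: mult_monom)

section \<open>Finite fields with a primitive element\<close>

locale finite_field_primitive =
  fixes \<omega> :: "'a::{field,finite}"
  assumes primitive: "primitive_element \<omega>"
begin

lemma \<omega>_nonzero: "\<omega> \<noteq> 0"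
  using primitive by (simp add: primitive_element_def)

definition N :: nat where "N = CARD('a) - 1"

lemma card_gt_1: "CARD('a) > 1"
proof -
  have "card {0, 1 :: 'a} \<le> CARD('a)" by (rule card_mono) auto
  then show ?thesis by simp
qed

lemma N_pos: "N > 0"
  using card_gt_1 by (simp add: N_def)

lemma card_units: "card (UNIV - {0 :: 'a}) = N"
  by (simp add: N_def card_Diff_singleton)

text \<open>Multiplication by \<open>\<omega>\<close> permutes the units, so the product of all
  units absorbs the factor \<open>\<omega> ^ N\<close>.\<close>

lemma \<omega>_power_card: "\<omega> ^ N = 1"
proof -
  have "(\<Prod>x\<in>UNIV - {0}. \<omega> * x) = \<Prod>(UNIV - {0})"
    by (rule prod.reindex_bij_witness[of _ "\<lambda>x. x / \<omega>" "\<lambda>x. \<omega> * x"]) (auto simp: \<omega>_nonzero)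
  then have "\<omega> ^ N * \<Prod>(UNIV - {0}) = \<Prod>(UNIV - {0 :: 'a})"
    by (simp add: prod.distrib card_units)
  then show ?thesis by simp
qed

lemma \<omega>_power_mod: "\<omega> ^ (i mod N) = \<omega> ^ i"
proof -
  have "\<omega> ^ i = \<omega> ^ (N * (i div N) + i mod N)" by simp
  then show ?thesis by (simp only: power_add power_mult \<omega>_power_card) simp
qed

lemma nonzero_eq_\<omega>_power:
  assumes "x \<noteq> 0"
  obtains i where "x = \<omega> ^ i" "i < N"
proof -
  from assms primitive obtain i where "x = \<omega> ^ i" unfolding primitive_element_def by blast
  then show ?thesis using that[of "i mod N"] N_pos by (simp add: \<omega>_power_mod)
qed

text \<open>The \<open>N\<close> exponents already reach all \<open>N\<close> units, so no two of
  them can collide.\<close>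

lemma inj_on_\<omega>_power: "inj_on (\<lambda>i. \<omega> ^ i) {..<N}"
proof (rule eq_card_imp_inj_on)
  have "(\<lambda>i. \<omega> ^ i) ` {..<N} = UNIV - {0}"
  proof (intro equalityI subsetI)
    fix x :: 'a assume "x \<in> UNIV - {0}"
    then have "x \<noteq> 0" by simp
    then show "x \<in> (\<lambda>i. \<omega> ^ i) ` {..<N}" by (auto elim: nonzero_eq_\<omega>_power)
  qed (auto simp: \<omega>_nonzero)
  then show "card ((\<lambda>i. \<omega> ^ i) ` {..<N}) = card {..<N}"
    by (simp add: card_units)
qed simp

lemma \<omega>_power_eq_1_iff: "\<omega> ^ i = 1 \<longleftrightarrow> N dvd i"
proof
  assume "\<omega> ^ i = 1"
  then have "\<omega> ^ (i mod N) = \<omega> ^ 0" by (simp add: \<omega>_power_mod)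
  then have "i mod N = 0"
    using inj_on_\<omega>_power N_pos by (intro inj_onD[OF inj_on_\<omega>_power]) auto
  then show "N dvd i" by (simp add: dvd_eq_mod_eq_0)
next
  assume "N dvd i"
  then show "\<omega> ^ i = 1" using \<omega>_power_mod[of i] by (simp add: dvd_eq_mod_eq_0)
qed

text \<open>Serves three times: for the units of \<open>K\<close>, for the cubes \<open>H\<close>
  and for the units of the prime field.\<close>

lemma roots_of_unity:
  assumes "d * e = N"
  shows "bij_betw (\<lambda>i. (\<omega> ^ e) ^ i) {..<d} {x. x ^ d = 1}"
proof -
  have pos: "d > 0" "e > 0" using assms N_pos by (auto intro!: gr0I)
  have "inj_on (\<lambda>i. (\<omega> ^ e) ^ i) {..<d}"
  proof (rule inj_onI)
    fix i j assume ij: "i \<in> {..<d}" "j \<in> {..<d}" "(\<omega> ^ e) ^ i = (\<omega> ^ e) ^ j"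
    then have "e * i = e * j"
      by (intro inj_onD[OF inj_on_\<omega>_power]) (use pos in \<open>auto simp: power_mult assms[symmetric] mult.commute[of _ e]\<close>)
    then show "i = j" using pos by simp
  qed
  moreover have "(\<lambda>i. (\<omega> ^ e) ^ i) ` {..<d} = {x. x ^ d = 1}"
  proof safe
    fix i
    have "((\<omega> ^ e) ^ i) ^ d = (\<omega> ^ (d * e)) ^ i" by (simp add: power_mult[symmetric] mult_ac)
    then show "((\<omega> ^ e) ^ i) ^ d = 1" by (simp only: assms \<omega>_power_card) simp
  next
    fix x :: 'a assume x: "x ^ d = 1"
    then have "x \<noteq> 0" using pos by (auto simp: power_0_left)
    then obtain i where i: "x = \<omega> ^ i" "i < N" by (rule nonzero_eq_\<omega>_power)
    have "\<omega> ^ (i * d) = 1" using x i by (simp add: power_mult)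
    then have "d * e dvd i * d" by (simp only: \<omega>_power_eq_1_iff assms)
    then have "e dvd i" using pos by (simp add: mult.commute[of i])
    then obtain j where j: "i = e * j" by blast
    then have "j < d" using i(2) assms pos by (metis mult.commute nat_mult_less_cancel1)
    then show "x \<in> (\<lambda>i. (\<omega> ^ e) ^ i) ` {..<d}" using i j by (auto simp: power_mult)
  qed
  ultimately show ?thesis by (simp add: bij_betw_def)
qed

end

section \<open>The subfield of order \<open>q\<close> and its nonzero cubes\<close>

locale cubic_subfield = finite_field_primitive \<omega> for \<omega> :: "'a::{field,finite}" +
  fixes p t r q c :: nat
  assumes prime_p: "prime p" and p_mod_3: "p mod 3 = 1" and t_pos: "t \<ge> 1"
    and q_def: "q = p ^ (3 * t)" and c_def: "c = (q - 1) div 3"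
    and card_field: "CARD('a) = q ^ r"
begin

lemma p_gt_3: "p > 3"
proof -
  have "p \<noteq> 2" "p \<noteq> 3" using p_mod_3 by auto
  then show ?thesis using prime_ge_2_nat[OF prime_p] by linarith
qed

lemma p_less_q: "p < q"
  unfolding q_def using p_gt_3 t_pos power_strict_increasing[of 1 "3 * t" p] by simp

lemma q_eq: "q = 3 * c + 1"
proof -
  have "q mod 3 = 1" unfolding q_def by (rule mod3_power_eq_1[OF p_mod_3])
  then show ?thesis unfolding c_def by presburger
qed

lemma c_pos: "c > 0" using q_eq p_less_q p_gt_3 by simp

lemma even_c: "even c"
proof -
  have "odd p" using prime_odd_nat[OF prime_p] p_gt_3 by simp
  then have "odd q" unfolding q_def by simp
  then show ?thesis using q_eq by simp
qed

lemma r_pos: "r > 0"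
  using card_gt_1 card_field by (auto intro!: gr0I)

text \<open>Translation by 1 permutes the field, so the field order, a power of \<open>p\<close>,
  vanishes in it.\<close>

lemma CHAR_eq_p: "CHAR('a) = p"
proof -
  have "(\<Sum>x\<in>UNIV. x + 1) = (\<Sum>x\<in>(UNIV :: 'a set). x)"
    by (rule sum.reindex_bij_witness[of _ "\<lambda>x. x - 1" "\<lambda>x. x + 1"]) auto
  then have "of_nat CARD('a) = (0 :: 'a)" by (simp add: sum.distrib)
  then have "of_nat p = (0 :: 'a)" unfolding card_field q_def by simp
  then have "CHAR('a) dvd p" by (simp add: of_nat_eq_0_iff_char_dvd)
  then show ?thesis using prime_p CHAR_not_1'[where 'a = 'a] by (auto simp: prime_nat_iff)
qed

lemma frobenius_sum: "(\<Sum>i\<in>A. f i :: 'a) ^ (p ^ n) = (\<Sum>i\<in>A. f i ^ (p ^ n))"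
  by (rule freshmans_dream_sum') (simp_all add: CHAR_eq_p prime_p)

lemma frobenius_add: "(x + y :: 'a) ^ (p ^ n) = x ^ (p ^ n) + y ^ (p ^ n)"
  by (rule freshmans_dream') (simp_all add: CHAR_eq_p prime_p)

text \<open>The subfield of order \<open>q\<close>, kept as a subset of the big field: as the fixed
  points of a Frobenius power it is visibly closed under the field operations.\<close>

definition K :: "'a set" where "K = {x. x ^ q = x}"

text \<open>The subgroup of index 3 in the units of \<open>K\<close>, that is, the nonzero cubes of
  \<open>K\<close>.\<close>

definition H :: "'a set" where "H = {x. x ^ c = 1}"

text \<open>The exponent equals \<open>(q ^ r - 1) / (q - 1)\<close>, so \<open>g\<close> has order
  \<open>q - 1\<close>.\<close>

definition g :: 'a where "g = \<omega> ^ Psi r q"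

lemma Psi_mult: "3 * c * Psi r q = N"
proof -
  have "int (3 * c * Psi r q) = (int q - 1) * (\<Sum>i<r. int q ^ i)"
    using q_eq by (simp add: Psi_def)
  also have "\<dots> = int q ^ r - 1" by (rule power_diff_1_eq[symmetric])
  also have "\<dots> = int N" using card_gt_1 by (simp add: N_def card_field of_nat_diff)
  finally show ?thesis by linarith
qed

lemma frobenius_q: "(x + y :: 'a) ^ q = x ^ q + y ^ q"
  unfolding q_def by (rule frobenius_add)

lemma K_closed:
  "0 \<in> K" "1 \<in> K"
  "x \<in> K \<Longrightarrow> y \<in> K \<Longrightarrow> x + y \<in> K" "x \<in> K \<Longrightarrow> y \<in> K \<Longrightarrow> x * y \<in> K"
  "x \<in> K \<Longrightarrow> x ^ n \<in> K" "x \<in> K \<Longrightarrow> inverse x \<in> K" "x \<in> K \<Longrightarrow> y \<in> K \<Longrightarrow> x / y \<in> K"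
  using p_less_q
  by (auto simp: K_def frobenius_q power_mult_distrib power_inverse power_divide)
     (metis power_mult mult.commute)

lemma K_minus: "x \<in> K \<Longrightarrow> - x \<in> K"
proof -
  have "odd q" using q_eq even_c by simp
  then show "x \<in> K \<Longrightarrow> - x \<in> K" by (simp add: K_def)
qed

lemma K_units: "K - {0} = {x. x ^ (3 * c) = 1}"
proof -
  have "x ^ q = x * x ^ (3 * c)" for x :: 'a
    by (subst q_eq) simp
  then show ?thesis using c_pos by (auto simp: K_def power_0_left)
qed

lemma bij_K_units: "bij_betw (\<lambda>i. g ^ i) {..<3 * c} (K - {0})"
  unfolding K_units g_def by (rule roots_of_unity[OF Psi_mult])

lemma g_K: "g \<in> K - {0}"
  using bij_betw_apply[OF bij_K_units, of 1] c_pos by simp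

lemma g_power_K: "g ^ i \<in> K - {0}" using g_K by (auto intro: K_closed)

lemma card_K: "card K = q"
proof -
  have "card (K - {0}) = 3 * c" using bij_betw_same_card[OF bij_K_units] by simp
  moreover have "card K = Suc (card (K - {0}))" by (rule card.remove) (auto intro: K_closed)
  ultimately show ?thesis by (simp add: q_eq)
qed

lemma g_power_eq_1_iff: "g ^ i = 1 \<longleftrightarrow> 3 * c dvd i"
proof -
  have pos: "Psi r q > 0" using Psi_mult N_pos by (auto intro!: gr0I)
  have "g ^ i = 1 \<longleftrightarrow> 3 * c * Psi r q dvd Psi r q * i"
    unfolding Psi_mult g_def by (simp add: power_mult[symmetric] \<omega>_power_eq_1_iff)
  also have "\<dots> \<longleftrightarrow> 3 * c dvd i" using pos by (simp add: mult.commute[of _ "Psi r q"])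
  finally show ?thesis .
qed

lemma g_power_H_iff: "g ^ i \<in> H \<longleftrightarrow> 3 dvd i"
  using c_pos by (simp add: H_def g_power_eq_1_iff power_mult[symmetric])

lemma H_subset_K: "H \<subseteq> K - {0}"
  unfolding K_units H_def by (auto simp: power_mult mult.commute[of 3])

lemma H_closed: "1 \<in> H" "x \<in> H \<Longrightarrow> y \<in> H \<Longrightarrow> x * y \<in> H" "x \<in> H \<Longrightarrow> inverse x \<in> H"
  by (auto simp: H_def power_mult_distrib power_inverse)

lemma bij_H: "bij_betw (\<lambda>j. g ^ (3 * j)) {..<c} H"
proof -
  have "c * (3 * Psi r q) = N" using Psi_mult by (simp add: algebra_simps)
  from roots_of_unity[OF this] show ?thesis
    by (simp add: H_def g_def power_mult[symmetric] mult_ac)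
qed

lemma card_H: "card H = c"
  using bij_betw_same_card[OF bij_H] by simp

lemma sum_K_split: "(\<Sum>x\<in>K. f x) = f 0 + (\<Sum>x\<in>K - {0}. f x)"
  by (rule sum.remove) (simp_all add: K_closed)

lemma sum_K_units: "(\<Sum>x\<in>K - {0}. f x) = (\<Sum>i<3 * c. f (g ^ i))"
  using sum.reindex_bij_betw[OF bij_K_units, of f] by simp

text \<open>Cubing maps the units of \<open>K\<close> three-to-one onto \<open>H\<close>: as
  \<open>i\<close> runs through \<open>3 * c\<close> exponents, \<open>g ^ (3 * i)\<close> runs
  through three periods of length \<open>c\<close>.\<close>

lemma sum_over_cubes:
  fixes f :: "'a \<Rightarrow> 'b::comm_semiring_1"
  shows "(\<Sum>y\<in>K. f (y ^ 3)) = f 0 + 3 * (\<Sum>h\<in>H. f h)"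
proof -
  have H: "(\<Sum>h\<in>H. f h) = (\<Sum>j<c. f (g ^ (3 * j)))"
    using sum.reindex_bij_betw[OF bij_H, of f] by simp
  have per: "(\<Sum>i<n * c. f (g ^ (3 * i))) = of_nat n * (\<Sum>j<c. f (g ^ (3 * j)))" for n
  proof (induction n)
    case (Suc n)
    have "g ^ (3 * (n * c + i)) = g ^ (3 * i)" for i
    proof -
      have "g ^ (3 * (n * c)) = 1" by (simp add: g_power_eq_1_iff)
      then show ?thesis by (simp add: power_add distrib_left)
    qed
    then have "(\<Sum>i<n * c + c. f (g ^ (3 * i))) = of_nat n * (\<Sum>j<c. f (g ^ (3 * j))) + (\<Sum>j<c. f (g ^ (3 * j)))"
      unfolding sum_lessThan_add Suc by simp
    then show ?case by (simp add: algebra_simps)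
  qed simp
  have "(\<Sum>y\<in>K. f (y ^ 3)) = f 0 + (\<Sum>i<3 * c. f (g ^ (3 * i)))"
    by (simp add: sum_K_split sum_K_units power_mult[symmetric] mult.commute)
  then show ?thesis using per[of 3] H by simp
qed

text \<open>The elements \<open>1\<close>, \<open>g\<close> and \<open>g ^ 2\<close> represent the
  three cosets of \<open>H\<close>, each of size \<open>c\<close>.\<close>

lemma sum_cubic_classes:
  fixes f :: "'a \<Rightarrow> 'b::comm_semiring_1"
  assumes "\<And>x h. h \<in> H \<Longrightarrow> f (x * h) = f x"
  shows "(\<Sum>x\<in>K - {0}. f x) = of_nat c * (f 1 + f g + f (g ^ 2))"
proof -
  have "(\<Sum>i<3 * n. f (g ^ i)) = of_nat n * (f 1 + f g + f (g ^ 2))" for n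
  proof (induction n)
    case (Suc n)
    have "f (g ^ (3 * n + i)) = f (g ^ i)" for i
      using assms[of "g ^ (3 * n)" "g ^ i"] by (simp add: g_power_H_iff power_add mult.commute)
    from this[of 0] this[of 1] this[of 2]
    have "(\<Sum>i<Suc (Suc (Suc (3 * n))). f (g ^ i)) = of_nat n * (f 1 + f g + f (g ^ 2)) + f 1 + f g + f (g ^ 2)"
      using Suc by (simp add: add.assoc)
    moreover have "3 * Suc n = Suc (Suc (Suc (3 * n)))" by simp
    ultimately show ?case by (simp only:) (simp add: algebra_simps)
  qed simp
  then show ?thesis by (simp add: sum_K_units)
qed

lemma card_cube_roots:
  "card {y \<in> K. y ^ 3 = v} = (if v = 0 then 1 else if v \<in> H then 3 else 0)"
proof -
  have "card {y \<in> K. y ^ 3 = v} = (\<Sum>y\<in>K. if y ^ 3 = v then 1 else 0)"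
    by (simp add: sum.If_cases Int_def conj_commute)
  also have "\<dots> = (if 0 = v then 1 else 0) + 3 * (\<Sum>h\<in>H. if h = v then 1 else 0)"
    by (rule sum_over_cubes)
  also have "(\<Sum>h\<in>H. if h = v then 1 else 0 :: nat) = (if v \<in> H then 1 else 0)"
    by (simp add: sum.delta)
  finally show ?thesis using H_subset_K by auto
qed

text \<open>For a unit \<open>v\<close>, the power \<open>v ^ c\<close> is a cubic residue symbol
  with values in the field itself. Counting modulo \<open>p\<close> thereby becomes the evaluation
  of power sums.\<close>

lemma of_nat_card_cube_roots:
  assumes "v \<in> K"
  shows "of_nat (card {y \<in> K. y ^ 3 = v}) = 1 + v ^ c + (v ^ c) ^ 2"
proof (cases "v = 0")
  case True
  then show ?thesis using c_pos card_cube_roots[of v] by (simp add: power_0_left)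
next
  case False
  then have "(v ^ c) ^ 3 = 1"
    using assms K_units by (auto simp: power_mult[symmetric] mult.commute)
  then have "(v ^ c - 1) * (1 + v ^ c + (v ^ c) ^ 2) = 0"
    by (simp add: algebra_simps power2_eq_square power3_eq_cube)
  then show ?thesis using False by (auto simp: card_cube_roots H_def)
qed

text \<open>The case \<open>j = 0\<close> is exceptional: since \<open>0 ^ 0 = 1\<close>, the sum is
  \<open>q\<close>, which vanishes in the field, and not \<open>q - 1\<close>.\<close>

lemma power_sum_K: "(\<Sum>x\<in>K. x ^ j) = (if j > 0 \<and> 3 * c dvd j then - 1 else 0)"
proof (cases "j = 0")
  case True
  have "p dvd q" unfolding q_def using t_pos by (intro dvd_power) auto
  then have "of_nat q = (0 :: 'a)" by (simp add: of_nat_eq_0_iff_char_dvd CHAR_eq_p)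
  then show ?thesis using True by (simp add: card_K)
next
  case False
  have S: "(\<Sum>x\<in>K. x ^ j) = (\<Sum>i<3 * c. (g ^ j) ^ i)"
    using False by (simp add: sum_K_split sum_K_units power_mult[symmetric] mult.commute)
  show ?thesis
  proof (cases "3 * c dvd j")
    case True
    then have "g ^ j = 1" by (simp add: g_power_eq_1_iff)
    have "p dvd q" unfolding q_def using t_pos by (intro dvd_power) auto
    then have "of_nat (3 * c + 1) = (0 :: 'a)" unfolding q_eq[symmetric] by (simp only: of_nat_eq_0_iff_char_dvd CHAR_eq_p)
    then have "of_nat (3 * c) = (- 1 :: 'a)" by (simp add: eq_neg_iff_add_eq_0 add.commute)
    then show ?thesis using True False S \<open>g ^ j = 1\<close> by simp
  next
    case nd: False
    have "(g ^ j) ^ (3 * c) = (g ^ (3 * c)) ^ j" by (simp add: power_mult[symmetric] mult.commute)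
    also have "g ^ (3 * c) = 1" by (simp add: g_power_eq_1_iff)
    finally have "(\<Sum>i<3 * c. (g ^ j) ^ i) = 0" using nd by (intro geometric_sum_eq_0) (auto simp: g_power_eq_1_iff)
    then show ?thesis using S nd by simp
  qed
qed

subsection \<open>Trace and additive character\<close>

text \<open>On \<open>K\<close> this is the absolute trace of the field of order \<open>q\<close>;
  outside \<open>K\<close> the value does not lie in the prime field.\<close>

definition tr :: "'a \<Rightarrow> 'a" where "tr x = trace_field p (3 * t) x"

lemma tr_add: "tr (x + y) = tr x + tr y"
  by (simp add: tr_def trace_field_def frobenius_add sum.distrib)

lemma tr_0: "tr 0 = 0"
  using prime_gt_0_nat[OF prime_p] by (simp add: tr_def trace_field_def power_0_left)

text \<open>Raising to the power \<open>p\<close> shifts the conjugates cyclically, since the last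
  one returns to \<open>x\<close>.\<close>

lemma tr_in_prime_field:
  assumes "x \<in> K"
  shows "tr x ^ p = tr x"
proof -
  define f where "f i = x ^ (p ^ i)" for i
  obtain n where n: "3 * t = Suc n" using t_pos by (cases "3 * t") auto
  have "p ^ Suc n = q" using n by (simp only: q_def)
  then have f: "f 0 = x" "f (Suc n) = x" using assms by (simp_all add: f_def K_def del: power_Suc)
  have "tr x ^ p = (\<Sum>i<Suc n. f (Suc i))"
    using frobenius_sum[of f "{..<Suc n}" 1]
    by (simp add: tr_def trace_field_def n f_def power_mult[symmetric] mult.commute[of "p ^ _" p] del: sum.lessThan_Suc)
  also have "\<dots> = (\<Sum>i<n. f (Suc i)) + f 0" using f by simp
  also have "\<dots> = tr x"
    by (simp add: tr_def trace_field_def n f_def[symmetric] sum.lessThan_Suc_shift add.commute del: sum.lessThan_Suc)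
  finally show ?thesis .
qed

lemma prime_field_power:
  fixes s :: 'a
  assumes "s ^ p = s"
  shows "s ^ (p ^ i) = s"
  by (induction i) (simp_all add: assms power_mult mult.commute[of p])

lemma tr_mult_prime_field: "s ^ p = s \<Longrightarrow> tr (s * x) = s * tr x"
  by (simp add: tr_def trace_field_def power_mult_distrib prime_field_power sum_distrib_left)

text \<open>The quotient \<open>(q - 1) / (p - 1)\<close> is a sum of \<open>3 * t\<close> powers of
  \<open>p\<close>, each 1 modulo 3, hence a multiple of 3. Consequently all units of the prime
  field are cubes in \<open>K\<close>.\<close>

lemma p_minus_1_dvd_c: "(p - 1) dvd c"
proof -
  have p: "int p mod 3 = 1" using p_mod_3 by presburger
  define S where "S = (\<Sum>i<3 * t. int p ^ i)"
  have "S mod 3 = (\<Sum>i<3 * t. int p ^ i mod 3) mod 3" unfolding S_def by (rule mod_sum_eq[symmetric])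
  also have "\<dots> = (\<Sum>i<3 * t. 1 :: int) mod 3"
  proof -
    have "int p ^ i mod 3 = 1" for i using power_mod[of "int p" 3 i] p by simp
    then show ?thesis by simp
  qed
  finally have "3 dvd S" by (simp add: dvd_eq_mod_eq_0)
  then obtain u where u: "S = 3 * u" by blast
  have "3 * int c = int q - 1" using q_eq by simp
  also have "\<dots> = (int p - 1) * S" unfolding S_def q_def by (simp add: power_diff_1_eq)
  finally have "int c = (int p - 1) * u" using u by simp
  then have "int (p - 1) dvd int c" using p_gt_3 by (simp add: of_nat_diff)
  then show ?thesis by (simp only: int_dvd_int_iff)
qed

lemma prime_field_units_in_H:
  fixes s :: 'a
  assumes "s ^ p = s" "s \<noteq> 0"
  shows "s \<in> H"
proof -
  have "s * s ^ (p - 1) = s" using assms(1) p_gt_3 by (metis One_nat_def Suc_lessD Suc_pred not_gr0 not_less0 numeral_3_eq_3 power_Suc)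
  then have "s ^ (p - 1) = 1" using assms(2) by simp
  then show ?thesis using p_minus_1_dvd_c by (auto simp: H_def power_mult elim!: dvdE)
qed

lemma of_nat_eq_iff_mod: "(of_nat m = (of_nat n :: 'a)) \<longleftrightarrow> m mod p = n mod p"
  by (simp add: of_nat_eq_iff_cong_CHAR CHAR_eq_p cong_def)

lemma of_nat_power_p: "(of_nat n :: 'a) ^ p = of_nat n"
proof (induction n)
  case 0
  then show ?case using p_gt_3 by simp
next
  case (Suc n)
  then show ?case using frobenius_add[of 1 "of_nat n" 1] by simp
qed

text \<open>One inclusion is clear, and both sides have \<open>p\<close> elements.\<close>

lemma prime_field_eq: "{x :: 'a. x ^ p = x} = of_nat ` {..<p}"
proof -
  have inj: "inj_on (of_nat :: nat \<Rightarrow> 'a) {..<p}"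
    by (rule inj_onI) (simp add: of_nat_eq_iff_mod)
  obtain d where d: "c = (p - 1) * d" using p_minus_1_dvd_c by blast
  have "(p - 1) * (d * (3 * Psi r q)) = N" unfolding Psi_mult[symmetric] d by (simp add: mult_ac)
  from bij_betw_same_card[OF roots_of_unity[OF this]]
  have c1: "card {x :: 'a. x ^ (p - 1) = 1} = p - 1" by simp
  have "x ^ p = x * x ^ (p - 1)" for x :: 'a using p_gt_3 by (simp add: power_eq_if)
  then have "{x :: 'a. x ^ p = x} = insert 0 {x. x ^ (p - 1) = 1}" by auto
  moreover have "0 \<notin> {x :: 'a. x ^ (p - 1) = 1}" using p_gt_3 by (simp add: power_0_left)
  ultimately have "card {x :: 'a. x ^ p = x} = p" using c1 p_gt_3 by simp
  moreover have "card ((of_nat :: nat \<Rightarrow> 'a) ` {..<p}) = p" using inj by (simp add: card_image)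
  moreover have "(of_nat :: nat \<Rightarrow> 'a) ` {..<p} \<subseteq> {x. x ^ p = x}" by (auto simp: of_nat_power_p)
  ultimately show ?thesis by (metis card_subset_eq finite)
qed

lemma tr_eq_of_nat:
  assumes "x \<in> K"
  obtains s where "s < p" "tr x = of_nat s"
proof -
  have "tr x \<in> of_nat ` {..<p}" using tr_in_prime_field[OF assms] prime_field_eq by blast
  then show ?thesis using that by blast
qed

text \<open>The trace is nonzero somewhere because \<open>\<Sum>x\<in>K. x ^ (q - 2) * tr x = - 1\<close>.\<close>

lemma ex_tr_eq_1: "\<exists>x\<in>K. tr x = 1"
proof -
  have "(\<Sum>x\<in>K. x ^ (3 * c - 1) * tr x) = (\<Sum>i<3 * t. \<Sum>x\<in>K. x ^ (3 * c - 1 + p ^ i))"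
    unfolding tr_def trace_field_def sum_distrib_left power_add by (rule sum.swap)
  also have "\<dots> = (\<Sum>i<3 * t. if i = 0 then - 1 else 0)"
  proof (rule sum.cong)
    fix i assume i: "i \<in> {..<3 * t}"
    have pi: "p ^ i \<ge> 1" using p_gt_3 by simp
    have "p ^ i < q" unfolding q_def using i p_gt_3 by (intro power_strict_increasing) auto
    \<comment> \<open>For \<open>i = 0\<close> the exponent is \<open>q - 1\<close>; for larger
      \<open>i\<close> it lies strictly between \<open>q - 1\<close> and twice that number.\<close>
    have e: "3 * c - 1 + p ^ i = 3 * c + (p ^ i - 1)" using c_pos pi by simp
    have "3 * c dvd p ^ i - 1 \<longleftrightarrow> i = 0"
    proof
      assume d: "3 * c dvd p ^ i - 1"
      have "p ^ i - 1 < 3 * c" using \<open>p ^ i < q\<close> q_eq pi by linarith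
      then have "p ^ i - 1 = 0" using d by (metis dvd_imp_le gr0I leD)
      then have "p ^ i = 1" using pi by simp
      then show "i = 0" using p_gt_3 by simp
    qed simp
    then have "3 * c dvd 3 * c - 1 + p ^ i \<longleftrightarrow> i = 0" unfolding e by simp
    then show "(\<Sum>x\<in>K. x ^ (3 * c - 1 + p ^ i)) = (if i = 0 then - 1 else 0)"
      using pi by (simp add: power_sum_K)
  qed simp
  also have "\<dots> = - 1" using t_pos by (simp add: sum.delta)
  finally have "\<exists>x\<in>K. tr x \<noteq> 0" by (metis (no_types, lifting) mult_zero_right neg_equal_0_iff_equal sum.neutral zero_neq_one)
  then obtain x where x: "x \<in> K" "tr x \<noteq> 0" by blast
  \<comment> \<open>The inverse trace value lies in the prime field, so scaling by it normalises the
    trace to 1.\<close>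
  have "inverse (tr x) ^ p = inverse (tr x)" using tr_in_prime_field[OF x(1)] by (simp add: power_inverse)
  then have "tr (inverse (tr x) * x) = inverse (tr x) * tr x" and "inverse (tr x) \<in> H"
    using x by (auto simp: tr_mult_prime_field prime_field_units_in_H)
  then show ?thesis using x H_subset_K by (intro bexI[of _ "inverse (tr x) * x"]) (auto intro!: K_closed(4))
qed

definition \<zeta> :: complex where "\<zeta> = cis (2 * pi / real p)"

lemma \<zeta>_power_p: "\<zeta> ^ p = 1"
  using p_gt_3 by (simp add: \<zeta>_def DeMoivre)

lemma \<zeta>_neq_1: "\<zeta> \<noteq> 1"
proof
  assume "\<zeta> = 1"
  then have "cis (2 * pi * real 1 / real p) = cis (2 * pi * real 0 / real p)" by (simp add: \<zeta>_def)
  moreover have "inj_on (\<lambda>k. cis (2 * pi * real k / real p)) {..<p}"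
    using bij_betw_roots_unity[of p] p_gt_3 by (simp add: bij_betw_def)
  ultimately have "(1 :: nat) = 0"
    using p_gt_3 by (intro inj_onD[where f = "\<lambda>k. cis (2 * pi * real k / real p)"]) auto
  then show False by simp
qed

lemma \<zeta>_power_mod: "\<zeta> ^ (n mod p) = \<zeta> ^ n"
proof -
  have "\<zeta> ^ n = \<zeta> ^ (p * (n div p) + n mod p)" by simp
  then show ?thesis by (simp only: power_add power_mult \<zeta>_power_p) simp
qed

text \<open>Trace values live in \<open>'a\<close>, so an integer representative has to be chosen.
  It is unique modulo \<open>p\<close>, which suffices because
  \<open>\<zeta> ^ p = 1\<close>.\<close>

definition \<psi> :: "'a \<Rightarrow> complex" where "\<psi> x = \<zeta> ^ (SOME n. of_nat n = tr x)"

lemma \<psi>_eq: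
  assumes "tr x = of_nat n"
  shows "\<psi> x = \<zeta> ^ n"
proof -
  have "of_nat (SOME n. of_nat n = tr x) = tr x" by (rule someI) (rule assms[symmetric])
  then have "(SOME n. of_nat n = tr x) mod p = n mod p" unfolding assms of_nat_eq_iff_mod .
  then show ?thesis unfolding \<psi>_def by (metis \<zeta>_power_mod)
qed

lemma \<psi>_add:
  assumes "x \<in> K" "y \<in> K"
  shows "\<psi> (x + y) = \<psi> x * \<psi> y"
proof -
  obtain m n where "tr x = of_nat m" "tr y = of_nat n" using assms tr_eq_of_nat by metis
  moreover from this have "tr (x + y) = of_nat (m + n)" by (simp add: tr_add)
  ultimately show ?thesis using \<psi>_eq by (metis power_add)
qed

lemma \<psi>_0: "\<psi> 0 = 1"
  using \<psi>_eq[of 0 0] by (simp add: tr_0)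

text \<open>Orthogonality: for \<open>a \<noteq> 0\<close>, a translation in the summation variable
  multiplies the sum by \<open>\<zeta> \<noteq> 1\<close>.\<close>

lemma sum_\<psi>_mult:
  assumes "a \<in> K"
  shows "(\<Sum>u\<in>K. \<psi> (u * a)) = (if a = 0 then of_nat q else 0)"
proof (cases "a = 0")
  case True
  then show ?thesis by (simp add: \<psi>_0 card_K)
next
  case False
  obtain x where x: "x \<in> K" "tr x = 1" using ex_tr_eq_1 by blast
  have "\<psi> x = \<zeta>" using \<psi>_eq[of x 1] x by simp
  define u where "u = x / a"
  have u: "u \<in> K" "u * a = x" using assms x False by (auto simp: u_def intro: K_closed)
  have "(\<Sum>v\<in>K. \<psi> (v * a)) = (\<Sum>v\<in>K. \<psi> ((v + u) * a))"
    by (rule sum.reindex_bij_witness[of _ "\<lambda>v. v + u" "\<lambda>v. v + - u"]) (auto intro: K_closed K_minus u simp del: add_uminus_conv_diff)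
  also have "\<dots> = \<zeta> * (\<Sum>v\<in>K. \<psi> (v * a))"
    unfolding sum_distrib_left
    by (rule sum.cong) (auto simp: distrib_right u \<psi>_add assms x K_closed \<open>\<psi> x = \<zeta>\<close>)
  finally show ?thesis using False \<zeta>_neq_1 by simp
qed

section \<open>Weights of the cubic code over the subfield and their exponential sums\<close>

definition W :: "'a \<Rightarrow> nat" where "W x = card {h \<in> H. tr (x * h) \<noteq> 0}"

definition Y :: "'a \<Rightarrow> nat" where "Y x = card {h \<in> H. tr (x * h) = 1}"

text \<open>\<open>E x\<close> is the value of the exponential sum \<open>\<Sum>y\<in>K. \<psi> (x * y ^ 3)\<close>, expressed by counting.\<close>

definition E :: "'a \<Rightarrow> int" where "E x = 1 + 3 * (int c - int (W x) - int (Y x))"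

lemma card_tr_eq_shift:
  assumes "h0 \<in> H"
  shows "card {h \<in> H. P (tr (x * h0 * h))} = card {h \<in> H. P (tr (x * h))}"
proof (rule bij_betw_same_card)
  have nz: "h0 \<noteq> 0" using assms H_subset_K by auto
  then have cancel: "h0 * (inverse h0 * h) = h" for h by simp
  show "bij_betw (\<lambda>h. h0 * h) {h \<in> H. P (tr (x * h0 * h))} {h \<in> H. P (tr (x * h))}"
    by (rule bij_betw_byWitness[where f' = "\<lambda>h. inverse h0 * h"])
       (use nz assms in \<open>auto simp: mult.assoc cancel intro: H_closed\<close>)
qed

lemma class_functions:
  assumes "h \<in> H"
  shows "W (x * h) = W x" "Y (x * h) = Y x" "E (x * h) = E x"
  using card_tr_eq_shift[OF assms, of "\<lambda>v. v \<noteq> 0" x] card_tr_eq_shift[OF assms, of "\<lambda>v. v = 1" x]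
  by (simp_all add: W_def Y_def E_def)

text \<open>The scalar \<open>s\<close> lies in \<open>H\<close>, and multiplication by it carries
  the fibre over 1 to the fibre over \<open>s\<close>.\<close>

lemma tr_fibres_H:
  assumes "0 < s" "s < p"
  shows "card {h \<in> H. tr (x * h) = of_nat s} = Y x"
proof -
  have nz: "of_nat s \<noteq> (0 :: 'a)" using assms of_nat_eq_iff_mod[of s 0] by simp
  have sH: "of_nat s \<in> H" using nz by (intro prime_field_units_in_H of_nat_power_p)
  have "tr (x * of_nat s * h) = of_nat s \<longleftrightarrow> tr (x * h) = 1" for h
    using tr_mult_prime_field[OF of_nat_power_p, of s "x * h"] nz by (simp add: mult_ac)
  then show ?thesis using card_tr_eq_shift[OF sH, of "\<lambda>v. v = of_nat s" x] by (simp add: Y_def)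
qed

text \<open>The fibre over 0 has \<open>c - W x\<close> elements and the \<open>p - 1\<close> others
  have \<open>Y x\<close> each. Applied to the constant 1 this relates \<open>W\<close> to
  \<open>Y\<close>; applied to \<open>\<psi>\<close> it evaluates the exponential sum.\<close>

lemma sum_by_trace_fibres:
  fixes f :: "nat \<Rightarrow> 'b::comm_semiring_1"
  assumes "x \<in> K" and F: "\<And>h s. h \<in> H \<Longrightarrow> tr (x * h) = of_nat s \<Longrightarrow> s < p \<Longrightarrow> F h = f s"
  shows "(\<Sum>h\<in>H. F h) = of_nat (c - W x) * f 0 + of_nat (Y x) * (\<Sum>s\<in>{0<..<p}. f s)"
proof -
  have p0: "{..<p} = insert 0 {0<..<p}" using p_gt_3 by auto
  have "(\<Union>s\<in>{..<p}. {h \<in> H. tr (x * h) = of_nat s}) = H"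
  proof (intro equalityI subsetI)
    fix h assume h: "h \<in> H"
    then have "x * h \<in> K" using assms(1) H_subset_K by (auto intro: K_closed)
    then show "h \<in> (\<Union>s\<in>{..<p}. {h \<in> H. tr (x * h) = of_nat s})"
      using h by (auto elim: tr_eq_of_nat)
  qed auto
  then have "(\<Sum>h\<in>H. F h) = sum F (\<Union>s\<in>{..<p}. {h \<in> H. tr (x * h) = of_nat s})" by simp
  also have "\<dots> = (\<Sum>s<p. \<Sum>h\<in>{h \<in> H. tr (x * h) = of_nat s}. F h)"
    by (rule sum.UNION_disjoint) (auto simp: of_nat_eq_iff_mod)
  also have "\<dots> = (\<Sum>s<p. of_nat (card {h \<in> H. tr (x * h) = of_nat s}) * f s)"
    by (rule sum.cong) (simp_all add: F)
  also have "\<dots> = of_nat (card {h \<in> H. tr (x * h) = 0}) * f 0 + (\<Sum>s\<in>{0<..<p}. of_nat (Y x) * f s)"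
    unfolding p0 by (simp add: tr_fibres_H)
  also have "card {h \<in> H. tr (x * h) = 0} = c - W x"
  proof -
    have "{h \<in> H. tr (x * h) = 0} = H - {h \<in> H. tr (x * h) \<noteq> 0}" by auto
    then show ?thesis by (simp add: card_Diff_subset W_def card_H)
  qed
  finally show ?thesis by (simp add: sum_distrib_left)
qed

lemma W_le_c: "W x \<le> c"
proof -
  have "W x \<le> card H" unfolding W_def by (rule card_mono) auto
  then show ?thesis by (simp add: card_H)
qed

lemma W_eq_Y:
  assumes "x \<in> K"
  shows "W x = (p - 1) * Y x"
proof -
  have "(\<Sum>h\<in>H. 1 :: nat) = of_nat (c - W x) * 1 + of_nat (Y x) * (\<Sum>s\<in>{0<..<p}. 1)"
    by (rule sum_by_trace_fibres[OF assms]) simp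
  then have "c = (c - W x) + Y x * (p - 1)" by (simp add: card_H)
  then have "W x = Y x * (p - 1)" using W_le_c[of x] by linarith
  then show ?thesis by (simp only: mult.commute)
qed

text \<open>By definition \<open>q - E x = 3 * (W x + Y x)\<close>, and
  \<open>W x = (p - 1) * Y x\<close> eliminates \<open>Y\<close>.\<close>

lemma W_eq_E:
  assumes "x \<in> K"
  shows "3 * int p * int (W x) = (int p - 1) * (int q - E x)"
proof -
  have "int (W x) = (int p - 1) * int (Y x)"
    using W_eq_Y[OF assms] p_gt_3 by (simp add: of_nat_diff)
  then have "(int p - 1) * (3 * int (W x) + 3 * int (Y x)) = 3 * int p * int (W x)" by (simp add: algebra_simps)
  then show ?thesis using q_eq by (simp add: E_def)
qed

text \<open>The nonzero trace values are equally frequent and the nontrivial powers of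
  \<open>\<zeta>\<close> sum to \<open>- 1\<close>; this makes the sum an integer.\<close>

lemma E_eq_sum_\<psi>:
  assumes "x \<in> K"
  shows "of_int (E x) = (\<Sum>y\<in>K. \<psi> (x * y ^ 3))"
proof -
  have "(\<Sum>h\<in>H. \<psi> (x * h)) = of_nat (c - W x) * \<zeta> ^ 0 + of_nat (Y x) * (\<Sum>s\<in>{0<..<p}. \<zeta> ^ s)"
    by (rule sum_by_trace_fibres[OF assms]) (simp add: \<psi>_eq)
  also have "(\<Sum>s\<in>{0<..<p}. \<zeta> ^ s) = - 1"
  proof -
    have "{..<p} = insert 0 {0<..<p}" using p_gt_3 by auto
    then have "(\<Sum>s<p. \<zeta> ^ s) = 1 + (\<Sum>s\<in>{0<..<p}. \<zeta> ^ s)" by simp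
    then show ?thesis using geometric_sum_eq_0[OF \<zeta>_power_p \<zeta>_neq_1] by (simp add: eq_neg_iff_add_eq_0 add.commute)
  qed
  finally have S: "(\<Sum>h\<in>H. \<psi> (x * h)) = of_nat c - of_nat (W x) - of_nat (Y x)"
    using W_le_c[of x] by (simp add: of_nat_diff)
  show ?thesis unfolding sum_over_cubes[of "\<lambda>v. \<psi> (x * v)"] S by (simp add: E_def \<psi>_0)
qed

subsection \<open>Moments of the cubic exponential sums\<close>

lemma E_0: "E 0 = int q"
  by (simp add: E_def W_def Y_def tr_0 q_eq)

text \<open>Orthogonality turns the sum over \<open>u\<close> into a count of zeros; all three
  moments below rest on this.\<close>

lemma sum_\<psi>_over:
  assumes "finite S" "\<And>i. i \<in> S \<Longrightarrow> \<phi> i \<in> K"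
  shows "(\<Sum>u\<in>K. \<Sum>i\<in>S. \<psi> (u * \<phi> i)) = of_nat (q * card {i \<in> S. \<phi> i = 0})"
proof -
  have "(\<Sum>u\<in>K. \<Sum>i\<in>S. \<psi> (u * \<phi> i)) = (\<Sum>i\<in>S. \<Sum>u\<in>K. \<psi> (u * \<phi> i))" by (rule sum.swap)
  also have "\<dots> = (\<Sum>i\<in>S. if \<phi> i = 0 then of_nat q else 0)"
    by (rule sum.cong) (simp_all add: sum_\<psi>_mult assms)
  also have "\<dots> = of_nat (q * card {i \<in> S. \<phi> i = 0})"
    using assms(1) by (simp add: sum.If_cases Int_def)
  finally show ?thesis .
qed

definition M2 :: nat where "M2 = card {(y, z). y \<in> K \<and> z \<in> K \<and> y ^ 3 + z ^ 3 = 0}"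

definition M3 :: nat where
  "M3 = card {((x, y), z). x \<in> K \<and> y \<in> K \<and> z \<in> K \<and> x ^ 3 + y ^ 3 + z ^ 3 = 0}"

lemma sum_E: "(\<Sum>u\<in>K. E u) = int q"
proof -
  have "of_int (\<Sum>u\<in>K. E u) = (\<Sum>u\<in>K. \<Sum>y\<in>K. \<psi> (u * y ^ 3))"
    by (simp add: E_eq_sum_\<psi>)
  also have "\<dots> = of_nat (q * card {y \<in> K. y ^ 3 = 0})"
    by (rule sum_\<psi>_over) (auto intro!: K_closed)
  also have "card {y \<in> K. y ^ 3 = 0} = 1" by (subst card_cube_roots) simp
  finally show ?thesis unfolding mult_1_right by (rule int_eq_of_complex)
qed

lemma sum_E_square: "(\<Sum>u\<in>K. E u ^ 2) = int (q * M2)"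
proof -
  have "of_int (\<Sum>u\<in>K. E u ^ 2) = (\<Sum>u\<in>K. \<Sum>v\<in>K \<times> K. \<psi> (u * (fst v ^ 3 + snd v ^ 3)))"
    unfolding of_int_sum of_int_power
  proof (rule sum.cong)
    fix u assume u: "u \<in> K"
    have "(of_int (E u) :: complex) ^ 2 = (\<Sum>y\<in>K. \<Sum>z\<in>K. \<psi> (u * y ^ 3) * \<psi> (u * z ^ 3))"
      by (simp add: E_eq_sum_\<psi> u power2_eq_square sum_product)
    also have "\<dots> = (\<Sum>y\<in>K. \<Sum>z\<in>K. \<psi> (u * (y ^ 3 + z ^ 3)))"
      by (intro sum.cong refl) (simp add: distrib_left \<psi>_add u K_closed)
    finally show "(of_int (E u) :: complex) ^ 2 = (\<Sum>v\<in>K \<times> K. \<psi> (u * (fst v ^ 3 + snd v ^ 3)))"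
      by (simp add: sum.cartesian_product case_prod_unfold)
  qed simp
  also have "\<dots> = of_nat (q * card {v \<in> K \<times> K. fst v ^ 3 + snd v ^ 3 = 0})"
    by (rule sum_\<psi>_over) (auto intro!: K_closed)
  also have "{v \<in> K \<times> K. fst v ^ 3 + snd v ^ 3 = 0} = {(y, z). y \<in> K \<and> z \<in> K \<and> y ^ 3 + z ^ 3 = 0}" by auto
  finally show ?thesis unfolding M2_def by (rule int_eq_of_complex)
qed

lemma sum_E_cube: "(\<Sum>u\<in>K. E u ^ 3) = int (q * M3)"
proof -
  let ?f = "\<lambda>v :: ('a \<times> 'a) \<times> 'a. fst (fst v) ^ 3 + snd (fst v) ^ 3 + snd v ^ 3"
  have "of_int (\<Sum>u\<in>K. E u ^ 3) = (\<Sum>u\<in>K. \<Sum>v\<in>(K \<times> K) \<times> K. \<psi> (u * ?f v))"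
    unfolding of_int_sum of_int_power
  proof (rule sum.cong)
    fix u assume u: "u \<in> K"
    have "(of_int (E u) :: complex) ^ 3 = (\<Sum>x\<in>K. \<Sum>y\<in>K. \<psi> (u * x ^ 3) * \<psi> (u * y ^ 3)) * (\<Sum>z\<in>K. \<psi> (u * z ^ 3))"
      by (simp add: E_eq_sum_\<psi> u power3_eq_cube sum_product[symmetric])
    also have "\<dots> = (\<Sum>v\<in>K \<times> K. \<psi> (u * fst v ^ 3) * \<psi> (u * snd v ^ 3)) * (\<Sum>z\<in>K. \<psi> (u * z ^ 3))"
      by (simp add: sum.cartesian_product case_prod_unfold)
    also have "\<dots> = (\<Sum>v\<in>K \<times> K. \<Sum>z\<in>K. \<psi> (u * (fst v ^ 3 + snd v ^ 3 + z ^ 3)))"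
      unfolding sum_product
      by (intro sum.cong refl) (auto simp: distrib_left \<psi>_add u K_closed)
    finally show "(of_int (E u) :: complex) ^ 3 = (\<Sum>v\<in>(K \<times> K) \<times> K. \<psi> (u * ?f v))"
      by (simp add: sum.cartesian_product case_prod_unfold)
  qed simp
  also have "\<dots> = of_nat (q * card {v \<in> (K \<times> K) \<times> K. ?f v = 0})"
    by (rule sum_\<psi>_over) (auto intro!: K_closed)
  also have "{v \<in> (K \<times> K) \<times> K. ?f v = 0} = {((x, y), z). x \<in> K \<and> y \<in> K \<and> z \<in> K \<and> x ^ 3 + y ^ 3 + z ^ 3 = 0}" by auto
  finally show ?thesis unfolding M3_def by (rule int_eq_of_complex)
qed

text \<open>As \<open>c\<close> is even, \<open>- 1\<close> is a cube, so each of the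
  \<open>3 * c\<close> units \<open>y\<close> admits exactly three \<open>z\<close>.\<close>

lemma M2_eq: "M2 = 1 + 9 * c"
proof -
  have "{(y, z). y \<in> K \<and> z \<in> K \<and> y ^ 3 + z ^ 3 = 0} = (SIGMA y:K. {z \<in> K. z ^ 3 = - (y ^ 3)})"
    by (auto simp: add_eq_0_iff)
  then have "M2 = (\<Sum>y\<in>K. card {z \<in> K. z ^ 3 = - (y ^ 3)})" by (simp add: M2_def)
  also have "\<dots> = 1 + (\<Sum>y\<in>K - {0}. card {z \<in> K. z ^ 3 = - (y ^ 3)})"
    unfolding sum_K_split card_cube_roots by simp
  also have "(\<Sum>y\<in>K - {0}. card {z \<in> K. z ^ 3 = - (y ^ 3)}) = (\<Sum>y\<in>K - {0}. 3)"
  proof (rule sum.cong)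
    fix y assume y: "y \<in> K - {0}"
    then have "- (y ^ 3) \<in> H" unfolding K_units H_def using even_c by (simp add: power_mult)
    then show "card {z \<in> K. z ^ 3 = - (y ^ 3)} = 3" unfolding card_cube_roots using y by simp
  qed simp
  finally show ?thesis using bij_betw_same_card[OF bij_K_units] by simp
qed

text \<open>Binomial expansion separates the two variables, leaving products of power sums over
  \<open>K\<close>.\<close>

lemma double_power_sum_cubes:
  "(\<Sum>x\<in>K. \<Sum>y\<in>K. (x ^ 3 + y ^ 3) ^ n)
     = (\<Sum>i\<le>n. of_nat (n choose i) * ((if i > 0 \<and> c dvd i then - 1 else 0) * (if n - i > 0 \<and> c dvd n - i then - 1 else 0)))"
proof -
  have ps: "(\<Sum>x\<in>K. (x ^ 3) ^ i) = (if i > 0 \<and> c dvd i then - 1 else 0)" for i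
    using power_sum_K[of "3 * i"] by (simp add: power_mult[symmetric])
  have "(\<Sum>x\<in>K. \<Sum>y\<in>K. (x ^ 3 + y ^ 3) ^ n) = (\<Sum>x\<in>K. \<Sum>y\<in>K. \<Sum>i\<le>n. of_nat (n choose i) * (x ^ 3) ^ i * (y ^ 3) ^ (n - i))"
    by (simp only: binomial_ring)
  also have "\<dots> = (\<Sum>x\<in>K. \<Sum>i\<le>n. \<Sum>y\<in>K. of_nat (n choose i) * (x ^ 3) ^ i * (y ^ 3) ^ (n - i))"
    by (intro sum.cong refl sum.swap)
  also have "\<dots> = (\<Sum>i\<le>n. \<Sum>x\<in>K. \<Sum>y\<in>K. of_nat (n choose i) * (x ^ 3) ^ i * (y ^ 3) ^ (n - i))"
    by (rule sum.swap)
  also have "\<dots> = (\<Sum>i\<le>n. of_nat (n choose i) * ((\<Sum>x\<in>K. (x ^ 3) ^ i) * (\<Sum>y\<in>K. (y ^ 3) ^ (n - i))))"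
    by (subst sum_product) (simp only: sum_distrib_left mult.assoc)
  finally show ?thesis unfolding ps .
qed

text \<open>The cubic symbol makes the number of \<open>z\<close> a polynomial in
  \<open>x ^ 3 + y ^ 3\<close> with exponents \<open>0\<close>, \<open>c\<close> and
  \<open>2 * c\<close>. Only the middle binomial term of the last one survives the
  summation.\<close>

lemma of_nat_M3: "of_nat M3 = (of_nat (2 * c choose c) :: 'a)"
proof -
  have "{((x, y), z). x \<in> K \<and> y \<in> K \<and> z \<in> K \<and> x ^ 3 + y ^ 3 + z ^ 3 = 0}
      = (SIGMA v:K \<times> K. {z \<in> K. z ^ 3 = - (fst v ^ 3 + snd v ^ 3)})"
    by (auto simp: add_eq_0_iff)
  then have "M3 = (\<Sum>v\<in>K \<times> K. card {z \<in> K. z ^ 3 = - (fst v ^ 3 + snd v ^ 3)})" by (simp add: M3_def)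
  then have "M3 = (\<Sum>x\<in>K. \<Sum>y\<in>K. card {z \<in> K. z ^ 3 = - (x ^ 3 + y ^ 3)})"
    by (simp add: sum.cartesian_product case_prod_unfold)
  then have "of_nat M3 = (\<Sum>x\<in>K. \<Sum>y\<in>K. of_nat (card {z \<in> K. z ^ 3 = - (x ^ 3 + y ^ 3)}) :: 'a)" by simp
  also have "\<dots> = (\<Sum>x\<in>K. \<Sum>y\<in>K. (x ^ 3 + y ^ 3) ^ 0 + (x ^ 3 + y ^ 3) ^ c + (x ^ 3 + y ^ 3) ^ (2 * c))"
  proof (intro sum.cong refl)
    fix x y assume "x \<in> K" "y \<in> K"
    then have "- (x ^ 3 + y ^ 3) \<in> K" by (intro K_closed K_minus)
    moreover have "(- (x ^ 3 + y ^ 3)) ^ c = (x ^ 3 + y ^ 3) ^ c" using even_c by (rule power_minus_even)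
    ultimately show "of_nat (card {z \<in> K. z ^ 3 = - (x ^ 3 + y ^ 3)}) = (x ^ 3 + y ^ 3) ^ 0 + (x ^ 3 + y ^ 3) ^ c + (x ^ 3 + y ^ 3) ^ (2 * c)"
      by (simp only: of_nat_card_cube_roots) (simp add: power_mult[symmetric] mult.commute)
  qed
  also have "\<dots> = (\<Sum>x\<in>K. \<Sum>y\<in>K. (x ^ 3 + y ^ 3) ^ 0) + (\<Sum>x\<in>K. \<Sum>y\<in>K. (x ^ 3 + y ^ 3) ^ c) + (\<Sum>x\<in>K. \<Sum>y\<in>K. (x ^ 3 + y ^ 3) ^ (2 * c))"
    by (simp only: sum.distrib)
  also have "(\<Sum>x\<in>K. \<Sum>y\<in>K. (x ^ 3 + y ^ 3) ^ 0) = 0"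
    unfolding double_power_sum_cubes by simp
  \<comment> \<open>Two positive multiples of \<open>c\<close> cannot add up to
    \<open>c\<close>.\<close>
  also have "(\<Sum>x\<in>K. \<Sum>y\<in>K. (x ^ 3 + y ^ 3) ^ c) = 0"
    unfolding double_power_sum_cubes by (rule sum.neutral) (auto dest: dvd_imp_le)
  also have "(\<Sum>x\<in>K. \<Sum>y\<in>K. (x ^ 3 + y ^ 3) ^ (2 * c)) = (\<Sum>i\<le>2 * c. if i = c then of_nat (2 * c choose c) else 0)"
    unfolding double_power_sum_cubes
  proof (rule sum.cong)
    fix i assume "i \<in> {..2 * c}"
    moreover have "i = c" if i: "0 < i" "c dvd i" "i < 2 * c"
    proof -
      obtain k where "i = c * k" using i(2) by blast
      then show ?thesis using i by (cases k) (auto simp: mult.commute)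
    qed
    ultimately show "of_nat (2 * c choose i) * ((if i > 0 \<and> c dvd i then - 1 else 0) * (if 2 * c - i > 0 \<and> c dvd 2 * c - i then - 1 else 0))
        = (if i = c then of_nat (2 * c choose c) else (0 :: 'a))"
      using c_pos by auto
  qed simp
  also have "\<dots> = of_nat (2 * c choose c)" by (simp add: sum.delta)
  finally show ?thesis by simp
qed

lemma p_not_dvd_M3: "\<not> p dvd M3"
proof
  assume "p dvd M3"
  then have "of_nat M3 = (0 :: 'a)" by (simp add: of_nat_eq_0_iff_char_dvd CHAR_eq_p)
  then have "p dvd (2 * c choose c)" unfolding of_nat_M3 by (simp add: of_nat_eq_0_iff_char_dvd CHAR_eq_p)
  then show False using not_prime_dvd_binomial_third[OF prime_p p_mod_3, of "3 * t"]
    by (simp add: c_def q_def)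
qed

lemma E_moment: "(\<Sum>u\<in>K. E u ^ n) = int q ^ n + int c * (E 1 ^ n + E g ^ n + E (g ^ 2) ^ n)"
  using sum_cubic_classes[of "\<lambda>u. E u ^ n"] by (simp add: sum_K_split E_0 class_functions)

theorem cubic_periods:
  assumes "4 * int p ^ t = a\<^sup>2 + 27 * b\<^sup>2" "a mod 3 = 1" "gcd a (int p) = 1"
  shows "\<exists>x y z. {#E 1, E g, E (g ^ 2)#} = {#x, y, z#} \<and> x = a * int p ^ t
    \<and> 2 * y = - (a + 9 * b) * int p ^ t \<and> 2 * z = - (a - 9 * b) * int p ^ t"
proof (rule multiset_of_cubic_periods[OF prime_p p_mod_3 t_pos, where M = "int M3"])
  let ?e0 = "E 1" and ?e1 = "E g" and ?e2 = "E (g ^ 2)"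
  have q: "int q = 3 * int c + 1" using q_eq by simp
  have iq: "int p ^ (3 * t) = int q" by (simp add: q_def)
  show s1: "?e0 + ?e1 + ?e2 = 0" using E_moment[of 1] sum_E c_pos by simp
  have "int q * int q + int c * (?e0\<^sup>2 + ?e1\<^sup>2 + ?e2\<^sup>2) = int q * (1 + 9 * int c)"
    using E_moment[of 2] sum_E_square M2_eq by (simp add: power2_eq_square algebra_simps)
  then have "int c * (?e0\<^sup>2 + ?e1\<^sup>2 + ?e2\<^sup>2) = int c * (6 * int q)" unfolding q by (simp add: algebra_simps)
  then show "?e0\<^sup>2 + ?e1\<^sup>2 + ?e2\<^sup>2 = 6 * int p ^ (3 * t)" unfolding iq using c_pos by simp
  have e2: "?e2 = - ?e0 - ?e1" using s1 by simp
  \<comment> \<open>As the three values sum to zero, the third moment determines their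
    product.\<close>
  have "?e0 ^ 3 + ?e1 ^ 3 + ?e2 ^ 3 = 3 * (?e0 * ?e1 * ?e2)"
    unfolding e2 by (simp add: power3_eq_cube algebra_simps)
  then have "int q ^ 3 + 3 * int c * (?e0 * ?e1 * ?e2) = int q * int M3"
    using E_moment[of 3] sum_E_cube by (simp add: mult.assoc)
  then show "(int p ^ (3 * t) - 1) * (?e0 * ?e1 * ?e2) = int p ^ (3 * t) * (int M3 - (int p ^ (3 * t))\<^sup>2)"
    unfolding iq by (simp add: q power2_eq_square power3_eq_cube algebra_simps)
  show "\<not> int p dvd int M3" using p_not_dvd_M3 by simp
  \<comment> \<open>This normalisation is built into \<open>E\<close>: each nonzero cube has three
    cube roots, and 0 contributes 1.\<close>
  show "?e0 mod 3 = 1" "?e1 mod 3 = 1" "?e2 mod 3 = 1" unfolding E_def by presburger+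
  show "4 * int p ^ t = a\<^sup>2 + 27 * b\<^sup>2" "a mod 3 = 1" by fact+
  show "\<not> int p dvd a"
  proof
    assume "int p dvd a"
    then have "int p dvd gcd a (int p)" by simp
    then show False unfolding assms(3) using prime_p by simp
  qed
qed

end

section \<open>The cyclic code\<close>

locale cubic_cyclic_code = cubic_subfield \<omega> p t r q c
  for \<omega> :: "'a::{field,finite}" and p t r q c +
  fixes k :: nat
  assumes prime_r: "prime r" and p_neq_r: "p \<noteq> r" and coprime_3_r: "gcd 3 r = 1"
    and q_mod_r: "q mod r = 1" and k_def: "k = 3 * Psi r q div r"
begin

text \<open>For \<open>j = r\<close> this makes the division in \<open>k\<close> exact; for
  \<open>0 < j < r\<close> it shows that the \<open>r\<close>-th roots of unity below are
  nontrivial.\<close>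

lemma cong_geometric_sum: "[(\<Sum>i<j. q ^ i) = j] (mod r)"
proof (induction j)
  case (Suc j)
  have "[q = 1] (mod r)" using q_mod_r prime_gt_1_nat[OF prime_r] by (simp add: cong_def)
  then have "[q ^ j = 1] (mod r)" using cong_pow[of q 1 r j] by simp
  then show ?case using cong_add[OF Suc, of "q ^ j" 1] by simp
qed simp

lemma k_mult_r: "k * r = 3 * Psi r q"
proof -
  have "r dvd Psi r q" using cong_geometric_sum[of r] by (simp add: Psi_def cong_def mod_eq_0_iff_dvd)
  then show ?thesis unfolding k_def by simp
qed

lemma k_mult_length: "k * (r * c) = N"
  using k_mult_r Psi_mult by (metis mult.assoc mult.commute)

definition \<beta> :: 'a where "\<beta> = \<omega> ^ k"

lemma \<beta>_nonzero: "\<beta> \<noteq> 0"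
  by (simp add: \<beta>_def \<omega>_nonzero)

lemma \<beta>_power_r: "\<beta> ^ r = g ^ 3"
  unfolding \<beta>_def g_def power_mult[symmetric] k_mult_r by (simp only: mult.commute)

section \<open>The relative trace down to \<open>K\<close> and Fourier inversion\<close>

definition relTr :: "'a \<Rightarrow> 'a" where "relTr x = (\<Sum>j<r. x ^ (q ^ j))"

lemma q_power_j: "q ^ j = p ^ (j * (3 * t))"
  by (simp add: q_def power_mult[symmetric] mult_ac)

lemma relTr_K: "relTr x \<in> K"
proof -
  obtain n where n: "r = Suc n" using r_pos by (cases r) auto
  have "x ^ (q ^ r) = x"
  proof (cases "x = 0")
    case False
    then obtain i where "x = \<omega> ^ i" by (rule nonzero_eq_\<omega>_power)
    then have "x ^ N = (\<omega> ^ N) ^ i" by (simp add: power_mult[symmetric] mult.commute)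
    then have "x ^ N = 1" by (simp add: \<omega>_power_card)
    moreover have "q ^ r = Suc N" using card_gt_1 card_field by (simp add: N_def)
    ultimately show ?thesis by simp
  qed (use p_less_q in \<open>simp add: power_0_left\<close>)
  then have xr: "x ^ (q ^ Suc n) = x" unfolding n .
  have Tn: "relTr x = (\<Sum>j<Suc n. x ^ (q ^ j))" unfolding relTr_def by (simp only: n)
  have "relTr x ^ q = (\<Sum>j<Suc n. (x ^ (q ^ j)) ^ q)"
    unfolding Tn using frobenius_sum[of "\<lambda>j. x ^ (q ^ j)" "{..<Suc n}" "3 * t"]
    by (simp only: q_def[symmetric])
  also have "\<dots> = (\<Sum>j<Suc n. x ^ (q ^ Suc j))" by (simp only: power_mult[symmetric] power_Suc mult.commute)
  also have "\<dots> = (\<Sum>j<n. x ^ (q ^ Suc j)) + x ^ (q ^ 0)" using xr by simp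
  also have "\<dots> = relTr x" unfolding Tn sum.lessThan_Suc_shift by (simp only: add.commute o_def)
  finally show ?thesis by (simp add: K_def)
qed

lemma K_power_q: "y \<in> K \<Longrightarrow> y ^ (q ^ j) = y"
  by (induction j) (simp_all add: K_def power_mult mult.commute)

lemma relTr_mult_K: "y \<in> K \<Longrightarrow> relTr (x * y) = relTr x * y"
  by (simp add: relTr_def power_mult_distrib K_power_q sum_distrib_right)

text \<open>Transitivity of the trace: the \<open>3 * t * r\<close> conjugates are grouped into
  \<open>r\<close> blocks of length \<open>3 * t\<close>.\<close>

lemma trace_tower: "trace_field p (3 * t * r) x = tr (relTr x)"
proof -
  have "trace_field p (3 * t * r) x = (\<Sum>i<r * (3 * t). x ^ (p ^ i))"
    by (simp add: trace_field_def mult.commute)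
  also have "\<dots> = (\<Sum>j<r. \<Sum>i\<in>{j * (3 * t)..<j * (3 * t) + 3 * t}. x ^ (p ^ i))"
    by (rule sum.nat_group[symmetric])
  also have "\<dots> = (\<Sum>j<r. \<Sum>i<3 * t. (x ^ (q ^ j)) ^ (p ^ i))"
  proof (rule sum.cong)
    fix j
    have "(\<Sum>i\<in>{j * (3 * t)..<j * (3 * t) + 3 * t}. x ^ (p ^ i)) = (\<Sum>i<3 * t. x ^ (p ^ (j * (3 * t) + i)))"
      using sum.shift_bounds_nat_ivl[of "\<lambda>i. x ^ (p ^ i)" 0 "j * (3 * t)" "3 * t"]
      by (simp add: atLeast0LessThan add.commute)
    then show "(\<Sum>i\<in>{j * (3 * t)..<j * (3 * t) + 3 * t}. x ^ (p ^ i)) = (\<Sum>i<3 * t. (x ^ (q ^ j)) ^ (p ^ i))"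
      by (simp only: q_power_j power_add power_mult[of x])
  qed simp
  also have "\<dots> = (\<Sum>i<3 * t. \<Sum>j<r. (x ^ (q ^ j)) ^ (p ^ i))" by (rule sum.swap)
  also have "\<dots> = tr (relTr x)" by (simp only: tr_def trace_field_def relTr_def frobenius_sum)
  finally show ?thesis .
qed

text \<open>Since \<open>\<beta> ^ r = g ^ 3\<close> is a unit of \<open>K\<close>, the base is an
  \<open>r\<close>-th root of unity. Were it 1 for some \<open>j > 0\<close>, then \<open>r\<close>
  would divide 3 times a number congruent to \<open>j\<close>, hence \<open>j\<close>
  itself.\<close>

lemma sum_\<beta>_conjugates:
  assumes "j < r"
  shows "(\<Sum>s<r. (\<beta> ^ (q ^ j - 1)) ^ s) = (if j = 0 then of_nat r else 0)"
proof (cases "j = 0")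
  case False
  have geo: "q ^ j - 1 = 3 * c * (\<Sum>i<j. q ^ i)"
  proof -
    have "int q ^ j - 1 = (int q - 1) * (\<Sum>i<j. int q ^ i)" by (rule power_diff_1_eq)
    then have "int q ^ j = int (3 * c * (\<Sum>i<j. q ^ i) + 1)" using q_eq by simp
    then have "q ^ j = 3 * c * (\<Sum>i<j. q ^ i) + 1" by (metis of_nat_eq_iff of_nat_power)
    then show ?thesis by simp
  qed
  have "(\<beta> ^ (q ^ j - 1)) ^ r = (\<beta> ^ r) ^ (q ^ j - 1)" by (simp only: power_mult[symmetric] mult.commute)
  also have "\<dots> = (g ^ (3 * c)) ^ (3 * (\<Sum>i<j. q ^ i))"
    unfolding \<beta>_power_r geo by (simp only: power_mult[symmetric] mult_ac)
  also have "g ^ (3 * c) = 1" by (simp add: g_power_eq_1_iff)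
  finally have root: "(\<beta> ^ (q ^ j - 1)) ^ r = 1" by simp
  have "\<beta> ^ (q ^ j - 1) \<noteq> 1"
  proof
    assume "\<beta> ^ (q ^ j - 1) = 1"
    then have "N dvd k * (3 * c * (\<Sum>i<j. q ^ i))"
      unfolding \<beta>_def geo power_mult[symmetric] \<omega>_power_eq_1_iff .
    then have "k * c * r dvd k * c * (3 * (\<Sum>i<j. q ^ i))"
      unfolding k_mult_length[symmetric] by (simp only: mult_ac)
    moreover have "k * c > 0" using k_mult_length N_pos by (auto intro!: gr0I)
    ultimately have "r dvd 3 * (\<Sum>i<j. q ^ i)" by (metis dvd_mult_cancel1 dvd_mult_cancel_left nat_mult_dvd_cancel1)
    then have "r dvd (\<Sum>i<j. q ^ i)"
      using coprime_3_r by (simp add: coprime_dvd_mult_right_iff coprime_iff_gcd_eq_1 gcd.commute)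
    then have "r dvd j" using cong_geometric_sum[of j] by (metis cong_dvd_iff)
    then show False using assms False by (auto dest: dvd_imp_le)
  qed
  then show ?thesis using geometric_sum_eq_0[OF root] False by simp
qed simp

text \<open>After expanding the traces into conjugates of \<open>\<gamma>\<close>, the sum over
  \<open>s\<close> cancels all of them except \<open>j = 0\<close>.\<close>

lemma relTr_inversion: "(\<Sum>s<r. relTr (\<gamma> * \<beta> ^ s) / \<beta> ^ s) = of_nat r * \<gamma>"
proof -
  have conj: "(\<gamma> * \<beta> ^ s) ^ (q ^ j) / \<beta> ^ s = \<gamma> ^ (q ^ j) * (\<beta> ^ (q ^ j - 1)) ^ s" for s j
  proof -
    obtain n where n: "q ^ j = Suc n" using p_less_q by (metis gr0_conv_Suc less_nat_zero_code neq0_conv zero_less_power)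
    have "(\<gamma> * \<beta> ^ s) ^ Suc n = \<gamma> ^ Suc n * (\<beta> ^ n) ^ s * \<beta> ^ s"
      by (simp add: power_mult_distrib power_mult[symmetric] power_add[symmetric] mult.commute)
    then show ?thesis unfolding n using \<beta>_nonzero by simp
  qed
  have "(\<Sum>s<r. relTr (\<gamma> * \<beta> ^ s) / \<beta> ^ s) = (\<Sum>s<r. \<Sum>j<r. \<gamma> ^ (q ^ j) * (\<beta> ^ (q ^ j - 1)) ^ s)"
    by (simp only: relTr_def sum_divide_distrib conj)
  also have "\<dots> = (\<Sum>j<r. \<gamma> ^ (q ^ j) * (\<Sum>s<r. (\<beta> ^ (q ^ j - 1)) ^ s))"
    unfolding sum_distrib_left by (rule sum.swap)
  also have "\<dots> = (\<Sum>j<r. if j = 0 then of_nat r * \<gamma> else 0)"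
    by (intro sum.cong refl, subst sum_\<beta>_conjugates) auto
  also have "\<dots> = of_nat r * \<gamma>" using r_pos by (simp add: sum.delta)
  finally show ?thesis .
qed

text \<open>The inversion formula gives injectivity, as \<open>p \<noteq> r\<close> makes
  \<open>r\<close> invertible in the field; both sides have \<open>q ^ r\<close> elements.\<close>

lemma bij_coordinates:
  "bij_betw (\<lambda>\<gamma>. restrict (\<lambda>s. relTr (\<gamma> * \<beta> ^ s)) {..<r}) UNIV ({..<r} \<rightarrow>\<^sub>E K)"
proof -
  let ?f = "\<lambda>\<gamma>. restrict (\<lambda>s. relTr (\<gamma> * \<beta> ^ s)) {..<r}"
  have "\<not> p dvd r" using prime_p prime_r p_neq_r primes_dvd_imp_eq by blast
  then have r0: "of_nat r \<noteq> (0 :: 'a)" by (simp add: of_nat_eq_0_iff_char_dvd CHAR_eq_p)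
  have inj: "inj ?f"
  proof (rule injI)
    fix x y assume eq: "?f x = ?f y"
    have "relTr (x * \<beta> ^ s) = relTr (y * \<beta> ^ s)" if "s < r" for s
      using that fun_cong[OF eq, of s] by simp
    then have "of_nat r * x = of_nat r * y" by (simp flip: relTr_inversion)
    then show "x = y" using r0 by simp
  qed
  have "?f ` UNIV \<subseteq> ({..<r} \<rightarrow>\<^sub>E K)" by (auto simp: relTr_K split: if_splits)
  moreover have "card (?f ` UNIV) = card ({..<r} \<rightarrow>\<^sub>E K)"
    using inj by (simp add: card_image card_PiE card_K card_field)
  ultimately have "?f ` UNIV = ({..<r} \<rightarrow>\<^sub>E K)" by (intro card_subset_eq) (auto intro: finite_PiE)
  then show ?thesis using inj by (simp add: bij_betw_def)
qed

section \<open>Weights, weight enumerator and frequencies of the cyclic code\<close>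

lemma cyc_weight_eq: "cyc_weight p (3 * t * r) k \<omega> \<gamma> = (\<Sum>s<r. W (relTr (\<gamma> * \<beta> ^ s)))"
proof -
  have "k > 0" using k_mult_length N_pos by (auto intro!: gr0I)
  then have len: "(CARD('a) - 1) div k = r * c"
    unfolding N_def[symmetric] k_mult_length[symmetric] by simp
  \<comment> \<open>At index \<open>r * j + s\<close> the power of \<open>\<omega>\<close> is
    \<open>\<beta> ^ s * g ^ (3 * j)\<close>, whose second factor lies in \<open>K\<close> and
    leaves the relative trace.\<close>
  have val: "trace_field p (3 * t * r) (\<gamma> * \<omega> ^ (k * (r * j + s))) = tr (relTr (\<gamma> * \<beta> ^ s) * g ^ (3 * j))" for j s
  proof -
    have "\<omega> ^ (k * (r * j + s)) = \<beta> ^ s * (\<beta> ^ r) ^ j"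
      by (simp add: \<beta>_def power_mult[symmetric] power_add[symmetric] algebra_simps)
    also have "\<dots> = \<beta> ^ s * g ^ (3 * j)" by (simp add: \<beta>_power_r power_mult)
    finally have "\<gamma> * \<omega> ^ (k * (r * j + s)) = (\<gamma> * \<beta> ^ s) * g ^ (3 * j)" by (simp add: mult.assoc)
    then show ?thesis using g_power_K[of "3 * j"] by (simp only: trace_tower) (simp add: relTr_mult_K)
  qed
  have "cyc_weight p (3 * t * r) k \<omega> \<gamma> = card (SIGMA s:{..<r}. {j \<in> {..<c}. tr (relTr (\<gamma> * \<beta> ^ s) * g ^ (3 * j)) \<noteq> 0})"
    unfolding cyc_weight_def len
  proof (rule bij_betw_same_card)
    show "bij_betw (\<lambda>i. (i mod r, i div r)) {i \<in> {0..<r * c}. trace_field p (3 * t * r) (\<gamma> * \<omega> ^ (k * i)) \<noteq> 0}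
       (SIGMA s:{..<r}. {j \<in> {..<c}. tr (relTr (\<gamma> * \<beta> ^ s) * g ^ (3 * j)) \<noteq> 0})"
    proof (rule bij_betw_byWitness[where f' = "\<lambda>(s, j). r * j + s"])
      show "(\<lambda>i. (i mod r, i div r)) ` {i \<in> {0..<r * c}. trace_field p (3 * t * r) (\<gamma> * \<omega> ^ (k * i)) \<noteq> 0}
        \<subseteq> (SIGMA s:{..<r}. {j \<in> {..<c}. tr (relTr (\<gamma> * \<beta> ^ s) * g ^ (3 * j)) \<noteq> 0})"
      proof safe
        fix i assume "i \<in> {0..<r * c}"
        then show "i div r < c" "i mod r < r" using r_pos by (auto simp: less_mult_imp_div_less mult.commute)
      next
        fix i assume "trace_field p (3 * t * r) (\<gamma> * \<omega> ^ (k * i)) \<noteq> 0" "tr (relTr (\<gamma> * \<beta> ^ (i mod r)) * g ^ (3 * (i div r))) = 0"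
        then show False using val[of "i div r" "i mod r"] by simp
      qed
      show "(\<lambda>(s, j). r * j + s) ` (SIGMA s:{..<r}. {j \<in> {..<c}. tr (relTr (\<gamma> * \<beta> ^ s) * g ^ (3 * j)) \<noteq> 0})
         \<subseteq> {i \<in> {0..<r * c}. trace_field p (3 * t * r) (\<gamma> * \<omega> ^ (k * i)) \<noteq> 0}"
      proof safe
        fix s j assume sj: "s < r" "j < c"
        have "r * j + s < r * Suc j" using sj by simp
        also have "\<dots> \<le> r * c" using sj by (intro mult_le_mono) auto
        finally show "r * j + s \<in> {0..<r * c}" by simp
      qed (simp add: val)
    qed auto
  qed
  also have "\<dots> = (\<Sum>s<r. card {j \<in> {..<c}. tr (relTr (\<gamma> * \<beta> ^ s) * g ^ (3 * j)) \<noteq> 0})" by simp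
  also have "\<dots> = (\<Sum>s<r. W (relTr (\<gamma> * \<beta> ^ s)))"
  proof (rule sum.cong)
    fix s
    have "bij_betw (\<lambda>j. g ^ (3 * j)) {j \<in> {..<c}. tr (relTr (\<gamma> * \<beta> ^ s) * g ^ (3 * j)) \<noteq> 0} {h \<in> H. tr (relTr (\<gamma> * \<beta> ^ s) * h) \<noteq> 0}"
      using bij_H unfolding bij_betw_def by (auto intro: inj_on_subset)
    then show "card {j \<in> {..<c}. tr (relTr (\<gamma> * \<beta> ^ s) * g ^ (3 * j)) \<noteq> 0} = W (relTr (\<gamma> * \<beta> ^ s))"
      unfolding W_def by (rule bij_betw_same_card)
  qed simp
  finally show ?thesis .
qed

text \<open>Weights are encoded as exponents, so they add under multiplication. By
  \<open>bij_coordinates\<close> the coordinates range independently over \<open>K\<close>, and the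
  sum factors.\<close>

lemma weight_enumerator:
  "(\<Sum>\<gamma>\<in>UNIV. monom 1 (cyc_weight p (3 * t * r) k \<omega> \<gamma>))
     = (1 + of_nat c * (monom 1 (W 1) + monom 1 (W g) + monom (1 :: nat) (W (g ^ 2)))) ^ r"
proof -
  have "(\<Sum>\<gamma>\<in>UNIV. monom (1 :: nat) (cyc_weight p (3 * t * r) k \<omega> \<gamma>))
      = (\<Sum>\<gamma>\<in>UNIV. \<Prod>s<r. monom 1 (W (restrict (\<lambda>s. relTr (\<gamma> * \<beta> ^ s)) {..<r} s)))"
    unfolding cyc_weight_eq prod_monom by simp
  also have "\<dots> = (\<Sum>f\<in>{..<r} \<rightarrow>\<^sub>E K. \<Prod>s<r. monom 1 (W (f s)))"
    by (rule sum.reindex_bij_betw[OF bij_coordinates])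
  also have "\<dots> = (\<Prod>s<r. \<Sum>x\<in>K. monom 1 (W x))"
    by (rule prod_sum_PiE[symmetric]) auto
  also have "(\<Sum>x\<in>K. monom (1 :: nat) (W x)) = 1 + of_nat c * (monom 1 (W 1) + monom 1 (W g) + monom 1 (W (g ^ 2)))"
  proof -
    \<comment> \<open>The zero coordinate has weight 0 and accounts for the summand 1.\<close>
    have "monom (1 :: nat) (W 0) = 1" by (simp add: W_def tr_0 one_pCons monom_0)
    then show ?thesis unfolding sum_K_split
      using sum_cubic_classes[of "\<lambda>x. monom (1 :: nat) (W x)"] by (simp only: class_functions)
  qed
  finally show ?thesis by simp
qed

lemma cyc_freq_eq_coeff:
  "cyc_freq p (3 * t * r) k \<omega> w = coeff (\<Sum>\<gamma>\<in>UNIV. monom 1 (cyc_weight p (3 * t * r) k \<omega> \<gamma>)) w"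
  by (simp add: cyc_freq_def coeff_sum sum.If_cases)

text \<open>The enumerator is symmetric in the three weights, so knowing them as a multiset is
  enough.\<close>

lemma cyc_freq_multinomial:
  assumes "{#W 1, W g, W (g ^ 2)#} = {#w1, w2, w3#}"
  shows "cyc_freq p (3 * t * r) k \<omega> w
    = (\<Sum>(l1, l2, l3)\<in>{(l1, l2, l3). l1 + l2 + l3 \<le> r \<and> l1 * w1 + l2 * w2 + l3 * w3 = w}.
       (r choose (l1 + l2 + l3)) * (fact (l1 + l2 + l3) div (fact l1 * fact l2 * fact l3)) * c ^ (l1 + l2 + l3))"
proof -
  let ?A = "{(l1, l2, l3). l1 + l2 + l3 \<le> r}"
  let ?m = "\<lambda>l1 l2 l3. (r choose (l1 + l2 + l3)) * (fact (l1 + l2 + l3) div (fact l1 * fact l2 * fact l3)) :: nat"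
  have "?A \<subseteq> {..r} \<times> {..r} \<times> {..r}" by auto
  then have fin: "finite ?A" by (rule finite_subset) simp
  have "sum_mset (image_mset (monom (1 :: nat)) {#W 1, W g, W (g ^ 2)#}) = sum_mset (image_mset (monom 1) {#w1, w2, w3#})"
    unfolding assms ..
  then have s: "monom 1 (W 1) + monom 1 (W g) + monom (1 :: nat) (W (g ^ 2)) = monom 1 w1 + (monom 1 w2 + monom 1 w3)"
    by (simp add: add_ac)
  have mc: "of_nat n * monom 1 w = monom n w" for n w :: nat
    by (simp add: of_nat_poly smult_monom)
  have "(\<Sum>\<gamma>\<in>UNIV. monom 1 (cyc_weight p (3 * t * r) k \<omega> \<gamma>)) = (1 + (monom c w1 + (monom c w2 + monom c w3))) ^ r"
    unfolding weight_enumerator s by (simp only: distrib_left mc)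
  also have "\<dots> = (\<Sum>(l1, l2, l3)\<in>?A. monom (?m l1 l2 l3 * c ^ (l1 + l2 + l3)) (l1 * w1 + l2 * w2 + l3 * w3))"
    unfolding multinomial_4
    by (intro sum.cong refl)
       (auto simp: monom_power mult_monom of_nat_poly smult_monom power_add mult_ac add_ac)
  finally have "cyc_freq p (3 * t * r) k \<omega> w = (\<Sum>(l1, l2, l3)\<in>?A. if l1 * w1 + l2 * w2 + l3 * w3 = w then ?m l1 l2 l3 * c ^ (l1 + l2 + l3) else 0)"
    unfolding cyc_freq_eq_coeff by (simp add: coeff_sum case_prod_unfold)
  also have "\<dots> = (\<Sum>(l1, l2, l3)\<in>{(l1, l2, l3). l1 + l2 + l3 \<le> r \<and> l1 * w1 + l2 * w2 + l3 * w3 = w}. ?m l1 l2 l3 * c ^ (l1 + l2 + l3))"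
    using fin by (intro sum.mono_neutral_cong_right) (auto split: if_splits)
  finally show ?thesis .
qed

lemma W_values:
  assumes "4 * int p ^ t = a\<^sup>2 + 27 * b\<^sup>2" "a mod 3 = 1" "gcd a (int p) = 1"
  obtains w1 w2 w3 where "{#W 1, W g, W (g ^ 2)#} = {#w1, w2, w3#}"
    "real w1 = (real p - 1) / (3 * real p) * (real q - real_of_int a * real p ^ t)"
    "real w2 = (real p - 1) / (3 * real p) * (real q + (real_of_int a + 9 * real_of_int b) / 2 * real p ^ t)"
    "real w3 = (real p - 1) / (3 * real p) * (real q + (real_of_int a - 9 * real_of_int b) / 2 * real p ^ t)"
proof -
  \<comment> \<open>\<open>V\<close> recovers \<open>W u\<close> from \<open>E u\<close>, the
    division being exact there. Being a function of the value alone, it can be mapped over the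
    multiset of periods.\<close>
  define V where "V e = nat ((int p - 1) * (int q - e) div (3 * int p))" for e
  from cubic_periods[OF assms] obtain x y z where xyz: "{#E 1, E g, E (g ^ 2)#} = {#x, y, z#}"
    "x = a * int p ^ t" "2 * y = - (a + 9 * b) * int p ^ t" "2 * z = - (a - 9 * b) * int p ^ t" by blast
  have WV: "W u = V (E u)" if "u \<in> K" for u
    unfolding V_def W_eq_E[OF that, symmetric] using p_gt_3 by simp
  have us: "1 \<in> K" "g \<in> K" "g ^ 2 \<in> K" using g_K K_closed by auto
  have "{#W 1, W g, W (g ^ 2)#} = image_mset V {#E 1, E g, E (g ^ 2)#}" by (simp add: WV us)
  then have ms: "{#W 1, W g, W (g ^ 2)#} = {#V x, V y, V z#}" unfolding xyz(1) by simp
  have val: "real (V e) = (real p - 1) / (3 * real p) * (real q - real_of_int e)" if "e \<in># {#x, y, z#}" for e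
  proof -
    from that obtain u where u: "u \<in> K" "e = E u" unfolding xyz(1)[symmetric] using us by auto
    have "real_of_int (3 * int p * int (W u)) = real_of_int ((int p - 1) * (int q - e))"
      using W_eq_E[OF u(1)] u(2) by simp
    then have "3 * real p * real (W u) = (real p - 1) * (real q - real_of_int e)" by simp
    then show ?thesis using WV[OF u(1)] u(2) p_gt_3 by (simp add: field_simps)
  qed
  have "2 * real_of_int y = real_of_int (- (a + 9 * b) * int p ^ t)" "2 * real_of_int z = real_of_int (- (a - 9 * b) * int p ^ t)"
    unfolding xyz(3,4)[symmetric] by simp_all
  then have y: "real_of_int y = - ((real_of_int a + 9 * real_of_int b) / 2 * real p ^ t)"
    and z: "real_of_int z = - ((real_of_int a - 9 * real_of_int b) / 2 * real p ^ t)" by (simp_all add: field_simps)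
  show ?thesis using that[OF ms] val[of x] val[of y] val[of z] xyz(2) y z by simp
qed

end

theorem theorem5p1:
  fixes p r t m q c k :: nat and a b :: int and \<omega> :: "'a::{field,finite}"
  assumes "prime p" and "prime r" and "p \<noteq> r"
    and "p mod 3 = 1" and "gcd 3 r = 1"
    and "t \<ge> 1" and "m = 3 * t" and "q = p ^ m" and "c = (q - 1) div 3"
    and "k = 3 * Psi r q div r"
    and "q mod r = 1"
    and "4 * int p ^ t = a ^ 2 + 27 * b ^ 2" and "a mod 3 = 1" and "gcd a (int p) = 1"
    and "CARD('a) = q ^ r"
    and "primitive_element \<omega>"
  defines "T \<equiv> {(l1::nat, l2::nat, l3::nat). l1 + l2 + l3 \<le> r}"
    and "wt \<equiv> (\<lambda>(l1, l2, l3). (real p - 1) / (3 * real p) *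
            (real (l1 + l2 + l3) * real q
             + (real_of_int a * ((real l2 + real l3) / 2 - real l1)
                + 9 * real_of_int b / 2 * (real l2 - real l3)) * real p ^ t))"
    and "A \<equiv> (\<lambda>(l1, l2, l3). (r choose (l1 + l2 + l3)) *
            (fact (l1 + l2 + l3) div (fact l1 * fact l2 * fact l3)) * c ^ (l1 + l2 + l3) :: nat)"
  shows "(\<forall>l\<in>T. \<exists>w::nat. wt l = real w)
    \<and> (\<forall>w::nat. cyc_freq p (m * r) k \<omega> w = (\<Sum>l\<in>{l\<in>T. wt l = real w}. A l))"
proof -
  interpret cubic_cyclic_code \<omega> p t r q c k
    using assms by unfold_locales auto
  obtain w1 w2 w3 where w: "{#W 1, W g, W (g ^ 2)#} = {#w1, w2, w3#}"
    "real w1 = (real p - 1) / (3 * real p) * (real q - real_of_int a * real p ^ t)"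
    "real w2 = (real p - 1) / (3 * real p) * (real q + (real_of_int a + 9 * real_of_int b) / 2 * real p ^ t)"
    "real w3 = (real p - 1) / (3 * real p) * (real q + (real_of_int a - 9 * real_of_int b) / 2 * real p ^ t)"
    using W_values[OF assms(12-14)] .
  have wt: "wt (l1, l2, l3) = real (l1 * w1 + l2 * w2 + l3 * w3)" for l1 l2 l3
  proof -
    \<comment> \<open>\<open>wt\<close> is linear in the tuple with coefficients \<open>w1\<close>,
      \<open>w2\<close>, \<open>w3\<close>; the identity is proved over arbitrary reals to keep the
      concrete values out of the algebra.\<close>
    have lin: "u * (real (l1 + l2 + l3) * Q + (A * ((real l2 + real l3) / 2 - real l1) + 9 * B / 2 * (real l2 - real l3)) * P)
      = real l1 * (u * (Q - A * P)) + real l2 * (u * (Q + (A + 9 * B) / 2 * P)) + real l3 * (u * (Q + (A - 9 * B) / 2 * P))"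
      for u Q P A B :: real by (simp add: algebra_simps add_divide_distrib diff_divide_distrib)
    show ?thesis unfolding wt_def prod.case lin w of_nat_add[of "l1 * w1 + l2 * w2"] of_nat_add[of "l1 * w1"] of_nat_mult ..
  qed
  have "{l \<in> T. wt l = real w} = {(l1, l2, l3). l1 + l2 + l3 \<le> r \<and> l1 * w1 + l2 * w2 + l3 * w3 = w}" for w
    unfolding T_def by (auto simp: wt simp del: of_nat_add of_nat_mult)
  then have "cyc_freq p (m * r) k \<omega> w = (\<Sum>l\<in>{l \<in> T. wt l = real w}. A l)" for w
    using cyc_freq_multinomial[OF w(1), of w] by (simp add: A_def \<open>m = 3 * t\<close>)
  moreover have "\<exists>w::nat. wt l = real w" for l by (cases l) (auto simp only: wt)
  ultimately show ?thesis by blast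
qed

end
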